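(* Let $m\ge 1$, $q_0=2^m$, $q=2^{2m+1}=2q_0^2$, and let $X_m$ be the Suzuki curve over $\mathbb{F}_q$ (defined in the context), with its unique point at infinity $P_\infty$. Let $\ell\in\mathbb{N}$ with $\ell\le q^2-1$. Then the set $$S'=\left\{x^a y^b z^c w^d (x^q+x)^r : \begin{array}{l} aq+b(q+q_0)+c(q+2q_0)+d(q+2q_0+1)+rq^2\le \ell(q^2+1),\\ 0\le a\le q-1,\ 0\le b\le 1,\ 0\le c\le q_0-1,\\ 0\le d\le q_0-1,\ 0\le r\le \ell\end{array}\right\}$$ is an $\mathbb{F}_q$-basis of the Riemann–Roch space $\mathcal{L}(\ell(q^2+1)P_\infty)$.
   Context: The Suzuki curve $X_m$ is the smooth projective curve over $\mathbb{F}_q$ with affine plane equation $y^q+y=x^{q_0}(x^q+x)$. It has a unique point $P_\infty$ lying over the point at infinity of the plane model; its genus is $g=q_0(q-1)$. The functions $x,y$ are the coordinate functions, $z:=x^{2q_0+1}-y^{2q_0}$ and $w:=xy^{2q_0}-z^{2q_0}$; the functions $x,y,z,w$ are regular outside $P_\infty$ with pole orders at $P_\infty$ equal to $q$, $q+q_0$, $q+2q_0$, $q+2q_0+1$ respectively. For a divisor $G$, $\mathcal{L}(G)=\{f: \operatorname{div}(f)+G\ge 0\}\cup\{0\}$. *)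

theory Defs
  imports "HOL-Computational_Algebra.Polynomial"
begin

text \<open>The function field F of the curve is modelled by a field type 'b together with
  a field homomorphism iota from the finite field 'a = F_q into it.\<close>

definition is_field_hom :: "('a::field \<Rightarrow> 'b::field) \<Rightarrow> bool" where
  "is_field_hom \<iota> \<longleftrightarrow> \<iota> 1 = 1 \<and> (\<forall>a b. \<iota> (a + b) = \<iota> a + \<iota> b) \<and> (\<forall>a b. \<iota> (a * b) = \<iota> a * \<iota> b)"

definition is_subfield :: "'b::field set \<Rightarrow> bool" where
  "is_subfield K \<longleftrightarrow> 0 \<in> K \<and> 1 \<in> K \<and> (\<forall>a\<in>K. \<forall>b\<in>K. a + b \<in> K \<and> a * b \<in> K)
     \<and> (\<forall>a\<in>K. - a \<in> K \<and> inverse a \<in> K)"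

definition generated_by :: "('a::field \<Rightarrow> 'b::field) \<Rightarrow> 'b \<Rightarrow> 'b \<Rightarrow> bool" where
  "generated_by \<iota> x y \<longleftrightarrow>
     (\<forall>K. is_subfield K \<and> range \<iota> \<subseteq> K \<and> x \<in> K \<and> y \<in> K \<longrightarrow> K = UNIV)"

definition transcendental_over :: "('a::field \<Rightarrow> 'b::field) \<Rightarrow> 'b \<Rightarrow> bool" where
  "transcendental_over \<iota> x \<longleftrightarrow> (\<forall>p::'a poly. p \<noteq> 0 \<longrightarrow> poly (map_poly \<iota> p) x \<noteq> 0)"

text \<open>A place of F/F_q, identified with its normalized discrete valuation
  (values on nonzero elements; by convention v 0 = 0).\<close>
definition is_place :: "('a::field \<Rightarrow> 'b::field) \<Rightarrow> ('b \<Rightarrow> int) \<Rightarrow> bool" where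
  "is_place \<iota> v \<longleftrightarrow> v 0 = 0
     \<and> (\<forall>a b. a \<noteq> 0 \<longrightarrow> b \<noteq> 0 \<longrightarrow> v (a * b) = v a + v b)
     \<and> (\<forall>a b. a \<noteq> 0 \<longrightarrow> b \<noteq> 0 \<longrightarrow> a + b \<noteq> 0 \<longrightarrow> v (a + b) \<ge> min (v a) (v b))
     \<and> (\<forall>c. c \<noteq> 0 \<longrightarrow> v (\<iota> c) = 0)
     \<and> (\<exists>t. t \<noteq> 0 \<and> v t = 1)"

definition RR_space :: "('a::field \<Rightarrow> 'b::field) \<Rightarrow> (('b \<Rightarrow> int) \<Rightarrow> int) \<Rightarrow> 'b set" where
  "RR_space \<iota> G = {f. f = 0 \<or> (\<forall>P. is_place \<iota> P \<longrightarrow> P f + G P \<ge> 0)}"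

definition Fq_basis :: "('a::field \<Rightarrow> 'b::field) \<Rightarrow> 'b set \<Rightarrow> 'b set \<Rightarrow> bool" where
  "Fq_basis \<iota> S V \<longleftrightarrow> finite S \<and> S \<subseteq> V
     \<and> (\<forall>c. (\<Sum>s\<in>S. \<iota> (c s) * s) = 0 \<longrightarrow> (\<forall>s\<in>S. c s = 0))
     \<and> (\<forall>v\<in>V. \<exists>c. v = (\<Sum>s\<in>S. \<iota> (c s) * s))"

end

theory Submission
  imports Defs "HOL-Algebra.Algebraic_Closure_Type" "HOL-Number_Theory.Residues"
begin

text \<open>
  In characteristic 2 the curve equation yields \<open>y\<^sup>2 = x z + w\<close>, \<open>z^q0 = y + x^(q0+1)\<close> and
  \<open>w^q0 = z + x^q0 y\<close>, so the monomials \<open>x^a y^b z^c w^d (x^q + x)^r\<close> within the stated ranges of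
  \<open>a, b, c, d\<close> (with \<open>r\<close> arbitrary) span the coordinate ring \<open>F_q[x, y]\<close>. At any place where \<open>x\<close> has
  a pole their pole orders are pairwise distinct multiples of one integer, which must be 1 because the
  place is normalized. Hence the monomials are linearly independent, the place is unique, and the
  pole order of a combination is the maximum of the weights that occur.

  It remains to show that a function without poles outside \<open>Pinf\<close> lies in the coordinate ring. Over the
  algebraic closure, every point \<open>(\<alpha>, \<beta>)\<close> of the affine curve gives an embedding
  \<open>x \<mapsto> \<alpha> + T\<close>, \<open>y \<mapsto> \<beta> + \<dots>\<close> of the function field into Laurent series, since
  \<open>Y^q + Y = h\<close> is solvable in power series; this gives a place. If \<open>f = R(x, y) / s(x)\<close> with
  \<open>deg_y R < q\<close> is regular at all of them and \<open>s(\<alpha>) = 0\<close>, then \<open>R(\<alpha>, Y)\<close> vanishes at the \<open>q\<close> points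
  \<open>\<beta>\<close> of the fibre over \<open>\<alpha>\<close>. So \<open>R(\<alpha>, Y) = 0\<close> and the minimal polynomial of \<open>\<alpha>\<close> cancels from the
  fraction.
\<close>

hide_const (open) Polynomials.degree Polynomials.lead_coeff Divisibility.prime
  UnivPoly.up_ring.monom UnivPoly.up_ring.coeff Module.module.smult

section \<open>Characteristic 2 and the relations of the curve\<close>

lemma add_power_CHAR_2:
  fixes a b :: "'c::comm_ring_1"
  assumes "CHAR('c) = 2"
  shows "(a + b) ^ (2 ^ n) = a ^ (2 ^ n) + b ^ (2 ^ n)"
proof (induction n)
  case (Suc n)
  have two: "(2::'c) = 0"
    using of_nat_CHAR[where 'a='c] assms by simp
  have sq: "(u + v)\<^sup>2 = u\<^sup>2 + v\<^sup>2" for u v :: 'c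
    using two by (simp add: power2_sum)
  show ?case
    using sq[of "a ^ 2 ^ n" "b ^ 2 ^ n"] by (simp add: Suc power_mult mult.commute[of 2])
qed simp

text \<open>The second form cancels equal summands that \<open>algebra_simps\<close> has made
  adjacent in a right-nested sum.\<close>

lemma add_self_CHAR_2:
  fixes a :: "'c::comm_ring_1"
  assumes "CHAR('c) = 2"
  shows "a + a = 0" and "a + (a + b) = b"
proof -
  show s: "a + a = 0"
    using of_nat_CHAR[where 'a='c] assms by (metis mult_2 mult_zero_left of_nat_numeral)
  show "a + (a + b) = b"
    by (simp add: s flip: add.assoc)
qed

lemma finite_field_power_card:
  fixes c :: "'a::{field,finite}"
  shows "c ^ card (UNIV :: 'a set) = c"
proof (cases "c = 0")
  case True
  then show ?thesis
    using finite_UNIV_card_ge_0[where ?'a='a] by auto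
next
  case False
  let ?U = "UNIV - {0::'a}"
  \<comment> \<open>Multiplication by \<open>c\<close> permutes the nonzero elements, so their
    product absorbs the factor \<open>c ^ card ?U\<close>.\<close>
  have "(\<Prod>d\<in>?U. d) = (\<Prod>d\<in>?U. c * d)"
    by (rule prod.reindex_bij_witness[of _ "\<lambda>d. c * d" "\<lambda>d. d / c"]) (use False in auto)
  also have "\<dots> = c ^ card ?U * (\<Prod>d\<in>?U. d)"
    by (simp add: prod.distrib)
  finally have "c ^ card ?U = 1"
    by (simp add: prod_zero_iff)
  moreover have "card (UNIV :: 'a set) = Suc (card ?U)"
    by (metis UNIV_I card_Suc_Diff1 finite)
  ultimately show ?thesis
    by (metis mult.right_neutral power_Suc)
qed

section \<open>Ring homomorphisms and evaluation of polynomials in two variables\<close>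

locale coeff_hom =
  fixes j :: "'a::comm_ring_1 \<Rightarrow> 'c::comm_ring_1"
  assumes hom_0 [simp]: "j 0 = 0" and hom_1 [simp]: "j 1 = 1"
    and hom_add [simp]: "j (a + b) = j a + j b"
    and hom_mult [simp]: "j (a * b) = j a * j b"
begin

lemma hom_minus [simp]: "j (- a) = - j a"
  using hom_add[of a "- a"] by (simp add: eq_neg_iff_add_eq_0 add.commute)

lemma hom_diff [simp]: "j (a - b) = j a - j b"
  using hom_add[of a "- b"] by simp

lemma hom_power [simp]: "j (a ^ n) = j a ^ n"
  by (induction n) auto

lemma hom_sum [simp]: "j (\<Sum>i\<in>I. f i) = (\<Sum>i\<in>I. j (f i))"
  by (induction I rule: infinite_finite_induct) auto

lemma map_poly_add: "map_poly j (p + q) = map_poly j p + map_poly j q"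
  by (intro poly_eqI) (simp add: coeff_map_poly)

lemma map_poly_mult: "map_poly j (p * q) = map_poly j p * map_poly j q"
  by (intro poly_eqI) (simp add: coeff_map_poly coeff_mult)

lemma poly_map_poly: "coeff_hom (\<lambda>p. poly (map_poly j p) u)"
  by unfold_locales (simp_all add: map_poly_add map_poly_mult)

end

text \<open>In \<open>'a poly poly\<close> the inner variable stands for x and the outer one for y;
  \<open>u\<close> is put for x and \<open>t\<close> for y.\<close>

definition eval2 :: "('a::comm_ring_1 \<Rightarrow> 'c::comm_ring_1) \<Rightarrow> 'c \<Rightarrow> 'c \<Rightarrow> 'a poly poly \<Rightarrow> 'c" where
  "eval2 j u t P = poly (map_poly (\<lambda>p. poly (map_poly j p) u) P) t"

context coeff_hom
begin

lemma eval2_hom: "coeff_hom (eval2 j u t)"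
  unfolding eval2_def by (rule coeff_hom.poly_map_poly[OF poly_map_poly])

lemma eval2_const: "eval2 j u t [:p:] = poly (map_poly j p) u"
  by (simp add: eval2_def map_poly_pCons)

lemma eval2_simps [simp]:
  "eval2 j u t [:[:a:]:] = j a" "eval2 j u t [:[:0, 1:]:] = u" "eval2 j u t [:0, 1:] = t"
  by (simp_all add: eval2_def map_poly_pCons)

end

text \<open>Fits predicates stable under addition and under multiplication by either variable: the
  spanning property below and the agreement of two evaluation maps.\<close>

lemma bipoly_induct [case_names const add mult_x mult_y]:
  fixes P :: "'a::comm_ring_1 poly poly"
  assumes const: "\<And>a. R [:[:a:]:]"
    and add: "\<And>P Q. R P \<Longrightarrow> R Q \<Longrightarrow> R (P + Q)"
    and mult_x: "\<And>P. R P \<Longrightarrow> R ([:[:0, 1:]:] * P)"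
    and mult_y: "\<And>P. R P \<Longrightarrow> R ([:0, 1:] * P)"
  shows "R P"
proof (induction P)
  case 0
  show ?case using const[of 0] by simp
next
  case (pCons p P)
  have "R [:p:]"
  proof (induction p)
    case 0
    show ?case using const[of 0] by simp
  next
    case (pCons a p)
    then show ?case
      using add[OF const[of a] mult_x[of "[:p:]"]] by simp
  qed
  then show ?case
    using add[OF _ mult_y[OF pCons.IH], of "[:p:]"] by simp
qed

section \<open>The functions z and w, the curve equation and the weighted monomials\<close>

definition suz_z :: "nat \<Rightarrow> 'c::comm_ring_1 \<Rightarrow> 'c \<Rightarrow> 'c" where
  "suz_z q0 x y = x ^ (2 * q0 + 1) - y ^ (2 * q0)"

definition suz_w :: "nat \<Rightarrow> 'c::comm_ring_1 \<Rightarrow> 'c \<Rightarrow> 'c" where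
  "suz_w q0 x y = x * y ^ (2 * q0) - suz_z q0 x y ^ (2 * q0)"

text \<open>The difference of the two sides of the curve equation, with q written as
  \<open>2 * q0\<^sup>2\<close>. It is defined over any commutative ring because it serves as an
  element of the function field, as a polynomial, and as a condition on points over the algebraic
  closure.\<close>

definition suz_rel :: "nat \<Rightarrow> 'c::comm_ring_1 \<Rightarrow> 'c \<Rightarrow> 'c" where
  "suz_rel q0 x y = y ^ (2 * q0\<^sup>2) + y - x ^ q0 * (x ^ (2 * q0\<^sup>2) + x)"

type_synonym expo = "nat \<times> nat \<times> nat \<times> nat \<times> nat"

fun suz_mon :: "nat \<Rightarrow> 'c::comm_ring_1 \<Rightarrow> 'c \<Rightarrow> expo \<Rightarrow> 'c" where
  "suz_mon q0 x y (a, b, c, d, r) =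
     x ^ a * y ^ b * suz_z q0 x y ^ c * suz_w q0 x y ^ d * (x ^ (2 * q0\<^sup>2) + x) ^ r"

text \<open>The expected pole order of \<open>suz_mon\<close> at infinity: x^q + x contributes
  q^2.\<close>

fun suz_wt :: "nat \<Rightarrow> expo \<Rightarrow> nat" where
  "suz_wt q0 (a, b, c, d, r) =
     a * (2 * q0\<^sup>2) + b * (2 * q0\<^sup>2 + q0) + c * (2 * q0\<^sup>2 + 2 * q0)
       + d * (2 * q0\<^sup>2 + 2 * q0 + 1) + r * (2 * q0\<^sup>2)\<^sup>2"

text \<open>The exponent \<open>r\<close> is unbounded here, since these monomials are to span the
  whole coordinate ring.\<close>

definition suz_expos :: "nat \<Rightarrow> expo set" where
  "suz_expos q0 = {(a, b, c, d, r). a < 2 * q0\<^sup>2 \<and> b \<le> 1 \<and> c < q0 \<and> d < q0}"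

lemma (in coeff_hom) hom_suz [simp]:
  "j (suz_z q0 a b) = suz_z q0 (j a) (j b)"
  "j (suz_w q0 a b) = suz_w q0 (j a) (j b)"
  "j (suz_rel q0 a b) = suz_rel q0 (j a) (j b)"
  "j (suz_mon q0 a b e) = suz_mon q0 (j a) (j b) e"
  by (cases e; simp add: suz_z_def suz_w_def suz_rel_def)+

text \<open>The terms in \<open>G\<close> are kept because the relations are also used in the polynomial ring, modulo \<open>G\<close>.\<close>
lemma suz_relations:
  fixes x y :: "'c::comm_ring_1"
  assumes char2: "CHAR('c) = 2" and q0: "q0 = 2 ^ m"
  defines "G \<equiv> suz_rel q0 x y" and "z \<equiv> suz_z q0 x y" and "w \<equiv> suz_w q0 x y"
  shows "z ^ q0 = y + x ^ (q0 + 1) + G"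
    and "y\<^sup>2 = x * z + w + G\<^sup>2"
    and "w ^ q0 = z + x ^ q0 * y + x ^ q0 * G + G ^ (2 * q0)"
proof -
  note add_self = add_self_CHAR_2[OF char2]
  note diff = minus_CHAR_2[OF char2]
  have frob: "(a + b) ^ q0 = a ^ q0 + b ^ q0" for a b :: 'c
    unfolding q0 by (rule add_power_CHAR_2[OF char2])
  have frob2: "(a + b)\<^sup>2 = a\<^sup>2 + b\<^sup>2" for a b :: 'c
    using add_power_CHAR_2[OF char2, of a b 1] by simp
  have z: "z = x ^ (2 * q0 + 1) + y ^ (2 * q0)"
    by (simp add: z_def suz_z_def diff)
  have yq: "y ^ (2 * q0\<^sup>2) = y + x ^ (q0 + 2 * q0\<^sup>2) + x ^ (q0 + 1) + G"
    by (simp add: G_def suz_rel_def diff add_self power_add algebra_simps)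
  have "z ^ q0 = x ^ (q0 + 2 * q0\<^sup>2) + y ^ (2 * q0\<^sup>2)"
    unfolding z frob by (simp add: algebra_simps power2_eq_square power_add flip: power_mult)
  then show zq0: "z ^ q0 = y + x ^ (q0 + 1) + G"
    unfolding yq by (simp add: add_self algebra_simps)
  \<comment> \<open>The power \<open>z ^ (2 * q0)\<close> in the definition of \<open>w\<close> is
    the square of \<open>z ^ q0\<close>, which is already known.\<close>
  have "w = x * y ^ (2 * q0) + (z ^ q0)\<^sup>2"
    by (simp add: w_def suz_w_def diff z_def mult.commute flip: power_mult)
  also have "\<dots> = x * (z + x ^ (2 * q0 + 1)) + y\<^sup>2 + x ^ (2 * q0 + 2) + G\<^sup>2"
    unfolding zq0 frob2 unfolding z
    by (simp add: add_self algebra_simps power2_eq_square power_add mult_2_right flip: power_mult)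
  finally have w: "w = x * z + y\<^sup>2 + G\<^sup>2"
    by (simp add: add_self algebra_simps)
  then show "y\<^sup>2 = x * z + w + G\<^sup>2"
    by (simp add: add_self algebra_simps)
  have "w ^ q0 = x ^ q0 * z ^ q0 + y ^ (2 * q0) + G ^ (2 * q0)"
    unfolding w frob by (simp add: power_mult_distrib flip: power_mult)
  also have "y ^ (2 * q0) = z + x ^ (2 * q0 + 1)"
    unfolding z by (simp add: add_self algebra_simps)
  finally show "w ^ q0 = z + x ^ q0 * y + x ^ q0 * G + G ^ (2 * q0)"
    unfolding zq0 by (simp add: add_self algebra_simps mult_2_right power_add)
qed

text \<open>As q = q0 * 2 q0, raising the formulas for \<open>z ^ q0\<close> and
  \<open>w ^ q0\<close> to the power 2 q0 gives the q-th powers. The resulting Artin-Schreier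
  equations determine the values of z and w at every place.\<close>

lemma suz_equations:
  fixes x y :: "'c::comm_ring_1"
  assumes char2: "CHAR('c) = 2" and q0: "q0 = 2 ^ m" and G: "suz_rel q0 x y = 0"
  defines "z \<equiv> suz_z q0 x y" and "w \<equiv> suz_w q0 x y"
  shows "z ^ (2 * q0\<^sup>2) + z = x ^ (2 * q0) * (x ^ (2 * q0\<^sup>2) + x)"
    and "w ^ (2 * q0\<^sup>2) + w = y ^ (2 * q0) * (x ^ (2 * q0\<^sup>2) + x)"
proof -
  note add_self = add_self_CHAR_2[OF char2]
  note diff = minus_CHAR_2[OF char2]
  note rel = suz_relations[OF char2 q0, where x = x and y = y, folded z_def w_def, unfolded G]
  have q0pos: "q0 > 0" by (simp add: q0)
  have frob: "(a + b) ^ (2 * q0) = a ^ (2 * q0) + b ^ (2 * q0)" for a b :: 'c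
    using add_power_CHAR_2[OF char2, of a b "Suc m"] by (simp add: q0)
  have pow: "u ^ (2 * q0\<^sup>2) = (u ^ q0) ^ (2 * q0)" for u :: 'c
    by (simp add: power2_eq_square algebra_simps flip: power_mult)
  have z: "z = x ^ (2 * q0 + 1) + y ^ (2 * q0)"
    by (simp add: z_def suz_z_def diff)
  have w: "w = x * y ^ (2 * q0) + z ^ (2 * q0)"
    by (simp add: w_def suz_w_def diff z_def)
  have "z ^ (2 * q0\<^sup>2) = y ^ (2 * q0) + (x ^ (q0 + 1)) ^ (2 * q0)"
    unfolding pow rel(1) by (simp add: frob)
  also have "(x ^ (q0 + 1)) ^ (2 * q0) = x ^ (2 * q0) * x ^ (2 * q0\<^sup>2)"
    by (simp add: power2_eq_square algebra_simps flip: power_mult power_add)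
  finally show "z ^ (2 * q0\<^sup>2) + z = x ^ (2 * q0) * (x ^ (2 * q0\<^sup>2) + x)"
    unfolding z by (simp add: add_self algebra_simps)
  have "w ^ (2 * q0\<^sup>2) = z ^ (2 * q0) + (x ^ q0 * y) ^ (2 * q0)"
    unfolding pow[of w] rel(3) using q0pos by (simp add: frob power_0_left)
  also have "(x ^ q0 * y) ^ (2 * q0) = x ^ (2 * q0\<^sup>2) * y ^ (2 * q0)"
    by (simp add: power_mult_distrib pow)
  finally show "w ^ (2 * q0\<^sup>2) + w = y ^ (2 * q0) * (x ^ (2 * q0\<^sup>2) + x)"
    unfolding w by (simp add: add_self algebra_simps)
qed

section \<open>Monomials spanning the coordinate ring\<close>

abbreviation bvar_x :: "'a::comm_ring_1 poly poly" where "bvar_x \<equiv> [:[:0, 1:]:]"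
abbreviation bvar_y :: "'a::comm_ring_1 poly poly" where "bvar_y \<equiv> [:0, 1:]"

text \<open>The span of the monomials plus the ideal of the curve, kept inside the polynomial ring
  so that the multiple of \<open>suz_rel\<close> is not lost; this later identifies the kernel of
  evaluation at (x, y).\<close>

inductive suz_span :: "nat \<Rightarrow> 'a::comm_ring_1 poly poly \<Rightarrow> bool" for q0 where
  mon: "e \<in> suz_expos q0 \<Longrightarrow> suz_span q0 ([:[:k:]:] * suz_mon q0 bvar_x bvar_y e)"
| ideal: "suz_span q0 (suz_rel q0 bvar_x bvar_y * P)"
| add: "suz_span q0 P \<Longrightarrow> suz_span q0 Q \<Longrightarrow> suz_span q0 (P + Q)"

context
  fixes q0 m :: nat
  assumes char2: "CHAR('a::comm_ring_1) = 2" and q0: "q0 = 2 ^ m"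
begin

lemma char2_bipoly: "CHAR('a poly poly) = 2"
  using char2 by simp

lemma suz_span_mult_const:
  fixes P :: "'a poly poly"
  shows "suz_span q0 P \<Longrightarrow> suz_span q0 ([:[:k:]:] * P)"
proof (induction rule: suz_span.induct)
  case (mon e k')
  then show ?case
    using suz_span.mon[OF mon, of "k * k'"] by simp
next
  case (ideal P)
  show ?case
    using suz_span.ideal[of q0 "[:[:k:]:] * P"] by (metis mult.left_commute)
next
  case (add P Q)
  then show ?case
    by (metis distrib_left suz_span.add)
qed

lemma suz_span_mon1:
  "e \<in> suz_expos q0 \<Longrightarrow> suz_span q0 (suz_mon q0 bvar_x bvar_y e :: 'a poly poly)"
  using suz_span.mon[of e q0 "1 :: 'a"] by (simp flip: one_pCons)

lemma suz_span_mult_x: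
  fixes P :: "'a poly poly"
  shows "suz_span q0 P \<Longrightarrow> suz_span q0 (bvar_x * P)"
proof (induction rule: suz_span.induct)
  case (mon e k)
  obtain a b c d r where e: "e = (a, b, c, d, r)" by (cases e)
  let ?q = "2 * q0\<^sup>2"
  have q: "?q \<ge> 2" by (simp add: q0)
  let ?x = "bvar_x :: 'a poly poly"
  have "suz_span q0 (?x * suz_mon q0 ?x bvar_y e)"
  proof (cases "Suc a < ?q")
    case True
    then have "(Suc a, b, c, d, r) \<in> suz_expos q0"
      using mon by (simp add: e suz_expos_def)
    from suz_span_mon1[OF this] show ?thesis
      by (simp add: e mult.assoc del: mult_pCons_left mult_pCons_right)
  next
    case False
    then have a: "?q = Suc a" using mon by (simp add: e suz_expos_def)
    \<comment> \<open>On overflow x^q is replaced by (x^q + x) + x: the first summand raises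
      \<open>r\<close>, the second leaves x to the first power.\<close>
    have "?x * ?x ^ a = (?x ^ ?q + ?x) + ?x"
      unfolding a
      by (simp add: add_self_CHAR_2[OF char2_bipoly] add.assoc del: mult_pCons_left mult_pCons_right add_pCons)
    then have "?x * ?x ^ a * t = (?x ^ ?q + ?x) * t + ?x * t" for t
      by (metis distrib_right)
    from this[of "bvar_y ^ b * suz_z q0 ?x bvar_y ^ c * suz_w q0 ?x bvar_y ^ d * (?x ^ ?q + ?x) ^ r"]
    have "?x * suz_mon q0 ?x bvar_y e =
        suz_mon q0 ?x bvar_y (0, b, c, d, Suc r) + suz_mon q0 ?x bvar_y (1, b, c, d, r)"
      unfolding e suz_mon.simps
      by (simp only: mult_ac power_0 power_Suc power_one_right mult_1_left mult_1_right)
    moreover have "(0, b, c, d, Suc r) \<in> suz_expos q0" "(1, b, c, d, r) \<in> suz_expos q0"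
      using mon order.strict_trans2[OF _ q, of 1] by (auto simp: e suz_expos_def)
    ultimately show ?thesis
      by (metis suz_span.add suz_span_mon1)
  qed
  from suz_span_mult_const[OF this, of k] show ?case
    by (metis mult.left_commute)
next
  case (ideal P)
  show ?case
    using suz_span.ideal[of q0 "bvar_x * P"] by (metis mult.left_commute)
next
  case (add P Q)
  then show ?case
    by (metis distrib_left suz_span.add)
qed

lemma suz_span_mult_x_power:
  fixes P :: "'a poly poly"
  shows "suz_span q0 P \<Longrightarrow> suz_span q0 (bvar_x ^ n * P)"
  by (induction n) (simp_all add: mult.assoc suz_span_mult_x del: mult_pCons_left mult_pCons_right)

text \<open>A second factor y is removed by \<open>y\<^sup>2 = x z + w + G\<^sup>2\<close>, which
  raises the exponent of z or w by one. If that exponent reaches q0, the other two relations lower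
  it; the powers of x that appear are harmless by \<open>suz_span_mult_x_power\<close>.\<close>

lemma suz_span_mult_y:
  fixes P :: "'a poly poly"
  shows "suz_span q0 P \<Longrightarrow> suz_span q0 (bvar_y * P)"
proof (induction rule: suz_span.induct)
  case (mon e k)
  obtain a b c d r where e: "e = (a, b, c, d, r)" by (cases e)
  define xx yy :: "'a poly poly" where "xx = bvar_x" and "yy = bvar_y"
  define z w G u where "z = suz_z q0 xx yy" and "w = suz_w q0 xx yy" and "G = suz_rel q0 xx yy"
    and "u = xx ^ (2 * q0\<^sup>2) + xx"
  note rel = suz_relations[OF char2_bipoly q0, where x = xx and y = yy, folded z_def w_def G_def]
  have ideal: "suz_span q0 (G * Q)" for Q
    unfolding G_def xx_def yy_def by (rule suz_span.ideal)
  have bnd: "a < 2 * q0\<^sup>2" "b \<le> 1" "c < q0" "d < q0"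
    using mon by (auto simp: e suz_expos_def)
  have q0pos: "q0 > 0" by (simp add: q0)
  have M: "suz_span q0 (xx ^ a * yy ^ b' * z ^ c' * w ^ d' * u ^ r)"
    if "b' \<le> 1" "c' < q0" "d' < q0" for b' c' d'
    using suz_span_mon1[of "(a, b', c', d', r)"] that bnd
    by (simp add: suz_expos_def xx_def yy_def z_def w_def u_def)
  \<comment> \<open>There is no factor y here, so the y coming from \<open>z ^ q0\<close> stays
    within the bound 1.\<close>
  have Mz: "suz_span q0 (xx ^ a * z ^ c' * w ^ d' * u ^ r)" if "c' \<le> q0" "d' < q0" for c' d'
  proof (cases "c' = q0")
    case True
    have "xx ^ a * z ^ c' * w ^ d' * u ^ r =
        xx ^ a * yy ^ 1 * z ^ 0 * w ^ d' * u ^ r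
        + xx ^ (q0 + 1) * (xx ^ a * yy ^ 0 * z ^ 0 * w ^ d' * u ^ r)
        + G * (xx ^ a * w ^ d' * u ^ r)"
      unfolding True rel by (simp add: algebra_simps)
    moreover have "suz_span q0 (xx ^ (q0 + 1) * (xx ^ a * yy ^ 0 * z ^ 0 * w ^ d' * u ^ r))"
      unfolding xx_def by (rule suz_span_mult_x_power) (fold xx_def, rule M, use that q0pos in auto)
    ultimately show ?thesis
      using M[of 1 0 d'] ideal that q0pos by (metis suz_span.add le_refl)
  next
    case False
    then show ?thesis
      using M[of 0 c' d'] that by simp
  qed
  \<comment> \<open>An overflow of w resets its exponent to 0 and yields either one more z, handled
    by \<open>Mz\<close>, or a single y with \<open>c\<close> unchanged.\<close>
  have Mw: "suz_span q0 (xx ^ a * z ^ c * w ^ Suc d * u ^ r)"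
  proof (cases "Suc d = q0")
    case True
    \<comment> \<open>Splits one factor \<open>G\<close> off \<open>G ^ (2 * q0)\<close>, showing
      that this term lies in the ideal.\<close>
    have "2 * q0 = Suc (2 * q0 - 1)" using q0pos by simp
    then have "G ^ (2 * q0) = G * G ^ (2 * q0 - 1)"
      by (metis power_Suc)
    then have "w ^ Suc d = z + xx ^ q0 * yy + G * (xx ^ q0 + G ^ (2 * q0 - 1))"
      unfolding True rel by (simp add: algebra_simps)
    then have "xx ^ a * z ^ c * w ^ Suc d * u ^ r =
        xx ^ a * z ^ Suc c * w ^ 0 * u ^ r
        + xx ^ q0 * (xx ^ a * yy ^ 1 * z ^ c * w ^ 0 * u ^ r)
        + G * ((xx ^ q0 + G ^ (2 * q0 - 1)) * xx ^ a * z ^ c * u ^ r)"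
      by (simp add: algebra_simps)
    moreover have "suz_span q0 (xx ^ q0 * (xx ^ a * yy ^ 1 * z ^ c * w ^ 0 * u ^ r))"
      unfolding xx_def by (rule suz_span_mult_x_power) (fold xx_def, rule M, use bnd in auto)
    moreover have "suz_span q0 (xx ^ a * z ^ Suc c * w ^ 0 * u ^ r)"
      using Mz[of "Suc c" 0] bnd by simp
    ultimately show ?thesis
      using ideal by (metis suz_span.add)
  next
    case False
    then show ?thesis
      using M[of 0 c "Suc d"] bnd by simp
  qed
  have "suz_span q0 (yy * (xx ^ a * yy ^ b * z ^ c * w ^ d * u ^ r))"
  proof (cases "b = 0")
    case True
    then show ?thesis
      using M[of 1 c d] bnd by (simp add: mult_ac)
  next
    case False
    then have "b = 1" using bnd by simp
    then have "yy * (xx ^ a * yy ^ b * z ^ c * w ^ d * u ^ r)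
        = yy\<^sup>2 * (xx ^ a * z ^ c * w ^ d * u ^ r)"
      by (simp add: power2_eq_square mult_ac)
    also have "\<dots> = xx * (xx ^ a * z ^ Suc c * w ^ d * u ^ r) + xx ^ a * z ^ c * w ^ Suc d * u ^ r
        + G * (G * xx ^ a * z ^ c * w ^ d * u ^ r)"
      unfolding rel(2) by (simp add: algebra_simps power2_eq_square)
    finally show ?thesis
      using suz_span_mult_x[of "xx ^ a * z ^ Suc c * w ^ d * u ^ r"] Mz[of "Suc c" d] Mw ideal bnd
      unfolding xx_def[symmetric] by (metis Suc_leI suz_span.add)
  qed
  then have "suz_span q0 (bvar_y * (suz_mon q0 bvar_x bvar_y e :: 'a poly poly))"
    by (simp add: e xx_def yy_def z_def w_def u_def del: mult_pCons_left mult_pCons_right)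
  from suz_span_mult_const[OF this, of k] show ?case
    by (metis mult.left_commute)
next
  case (ideal P)
  show ?case
    using suz_span.ideal[of q0 "bvar_y * P"] by (metis mult.left_commute)
next
  case (add P Q)
  then show ?case
    by (metis distrib_left suz_span.add)
qed

lemma suz_span_all:
  fixes P :: "'a poly poly"
  shows "suz_span q0 P"
proof (induction P rule: bipoly_induct)
  case (const a)
  have "(0, 0, 0, 0, 0) \<in> suz_expos q0" by (simp add: suz_expos_def q0)
  from suz_span.mon[OF this, of a] show ?case by simp
qed (fact suz_span.add suz_span_mult_x suz_span_mult_y)+

lemma suz_span_repr:
  fixes P :: "'a poly poly"
  shows "suz_span q0 P \<Longrightarrow> \<exists>I \<gamma>. finite I \<and> I \<subseteq> suz_expos q0 \<and>
    suz_rel q0 bvar_x bvar_y dvd P - (\<Sum>e\<in>I. [:[:\<gamma> e:]:] * suz_mon q0 bvar_x bvar_y e)"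
proof (induction rule: suz_span.induct)
  case (mon e k)
  then show ?case
    by (intro exI[of _ "{e}"] exI[of _ "\<lambda>_. k"]) simp
next
  case (ideal P)
  show ?case
    by (intro exI[of _ "{}"]) simp
next
  case (add P Q)
  let ?M = "suz_mon q0 bvar_x bvar_y :: expo \<Rightarrow> 'a poly poly"
  let ?C = "\<lambda>k::'a. [:[:k:]:]"
  from add.IH obtain I \<gamma> J \<delta> where IJ: "finite I" "I \<subseteq> suz_expos q0" "finite J" "J \<subseteq> suz_expos q0"
    and d: "suz_rel q0 bvar_x bvar_y dvd P - (\<Sum>e\<in>I. ?C (\<gamma> e) * ?M e)"
      "suz_rel q0 bvar_x bvar_y dvd Q - (\<Sum>e\<in>J. ?C (\<delta> e) * ?M e)"
    by blast
  \<comment> \<open>Both coefficient families are extended by zero to the union of their supports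
    and added.\<close>
  define \<epsilon> where "\<epsilon> e = (if e \<in> I then \<gamma> e else 0) + (if e \<in> J then \<delta> e else 0)" for e
  have "(\<Sum>e\<in>I. ?C (\<gamma> e) * ?M e) = (\<Sum>e\<in>I \<union> J. ?C (if e \<in> I then \<gamma> e else 0) * ?M e)"
    by (rule sum.mono_neutral_cong_left) (use IJ in auto)
  moreover have "(\<Sum>e\<in>J. ?C (\<delta> e) * ?M e) = (\<Sum>e\<in>I \<union> J. ?C (if e \<in> J then \<delta> e else 0) * ?M e)"
    by (rule sum.mono_neutral_cong_left) (use IJ in auto)
  moreover have "?C (\<epsilon> e) * ?M e =
      ?C (if e \<in> I then \<gamma> e else 0) * ?M e + ?C (if e \<in> J then \<delta> e else 0) * ?M e" for e
    proof -
    have "?C (k + k') = ?C k + ?C k'" for k k' by simp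
    then show ?thesis unfolding \<epsilon>_def by (simp only: distrib_right)
  qed
  ultimately have eq: "P + Q - (\<Sum>e\<in>I \<union> J. ?C (\<epsilon> e) * ?M e) =
      (P - (\<Sum>e\<in>I. ?C (\<gamma> e) * ?M e)) + (Q - (\<Sum>e\<in>J. ?C (\<delta> e) * ?M e))"
    by (simp only: sum.distrib) simp
  have "suz_rel q0 bvar_x bvar_y dvd P + Q - (\<Sum>e\<in>I \<union> J. ?C (\<epsilon> e) * ?M e)"
    unfolding eq by (rule dvd_add[OF d])
  moreover have "finite (I \<union> J)" "I \<union> J \<subseteq> suz_expos q0"
    using IJ by auto
  ultimately show ?case
    by blast
qed

end

section \<open>Places and pole orders\<close>

lemma field_hom_coeff_hom:
  assumes "is_field_hom \<iota>"
  shows "coeff_hom \<iota>"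
proof
  show add: "\<iota> (a + b) = \<iota> a + \<iota> b" for a b
    using assms by (simp add: is_field_hom_def)
  show "\<iota> 0 = 0"
    using add[of 0 0] by (metis add_cancel_right_right)
qed (use assms in \<open>simp_all add: is_field_hom_def\<close>)

locale place =
  fixes \<iota> :: "'a::field \<Rightarrow> 'b::field" and v :: "'b \<Rightarrow> int"
  assumes hom: "is_field_hom \<iota>" and place: "is_place \<iota> v"
begin

sublocale \<iota>: coeff_hom \<iota>
  by (rule field_hom_coeff_hom[OF hom])

lemma v_mult: "a \<noteq> 0 \<Longrightarrow> b \<noteq> 0 \<Longrightarrow> v (a * b) = v a + v b"
  using place by (simp add: is_place_def)

lemma v_add: "a \<noteq> 0 \<Longrightarrow> b \<noteq> 0 \<Longrightarrow> a + b \<noteq> 0 \<Longrightarrow> min (v a) (v b) \<le> v (a + b)"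
  using place by (simp add: is_place_def)

lemma v_const: "c \<noteq> 0 \<Longrightarrow> v (\<iota> c) = 0"
  using place by (simp add: is_place_def)

lemma v_0: "v 0 = 0"
  using place by (simp add: is_place_def)

lemma v_1: "v 1 = 0"
  using v_const[of 1] by simp

lemma v_minus: "v (- a) = v a"
  using v_mult[of "- 1" a] v_const[of "- 1"] by (cases "a = 0") auto

lemma v_power: "a \<noteq> 0 \<Longrightarrow> v (a ^ n) = int n * v a"
  by (induction n) (simp_all add: v_1 v_mult algebra_simps)

lemma v_add_strict:
  assumes "a \<noteq> 0" "b \<noteq> 0" "v a < v b"
  shows "a + b \<noteq> 0" and "v (a + b) = v a"
proof -
  show nz: "a + b \<noteq> 0"
    using assms v_minus[of a] by (metis add_eq_0_iff less_irrefl)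
  have "min (v (a + b)) (v (- b)) \<le> v (a + b + - b)"
    using nz assms by (intro v_add) auto
  then show "v (a + b) = v a"
    using assms v_add[OF assms(1,2) nz] by (simp add: v_minus)
qed

text \<open>The terms have distinct values, so the strict triangle inequality applies at every
  insertion and nothing cancels.\<close>

lemma v_sum:
  assumes "finite I" "I \<noteq> {}" "\<And>i. i \<in> I \<Longrightarrow> f i \<noteq> 0" "inj_on (v \<circ> f) I"
  shows "sum f I \<noteq> 0 \<and> v (sum f I) = Min ((v \<circ> f) ` I)"
  using assms
proof (induction I rule: finite_ne_induct)
  case (insert i I)
  then have IH: "sum f I \<noteq> 0" "v (sum f I) = Min ((v \<circ> f) ` I)" and fi: "f i \<noteq> 0"
    by (auto simp: inj_on_def)
  \<comment> \<open>The value of the partial sum is the value of one of its terms, hence differs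
    from that of the new term.\<close>
  have "v (sum f I) \<in> (v \<circ> f) ` I"
    unfolding IH using insert.hyps by (intro Min_in) auto
  then have ne: "v (f i) \<noteq> v (sum f I)"
    using insert.prems(2) insert.hyps by (auto simp: inj_on_def)
  have min: "Min ((v \<circ> f) ` insert i I) = min (v (f i)) (v (sum f I))"
    using insert.hyps by (simp add: IH)
  show ?case
  proof (cases "v (f i) < v (sum f I)")
    case True
    then show ?thesis
      using v_add_strict[OF fi IH(1) True] insert.hyps unfolding min by simp
  next
    case False
    then have "v (sum f I) < v (f i)" using ne by simp
    then show ?thesis
      using v_add_strict[OF IH(1) fi] insert.hyps unfolding min by (simp add: add.commute)
  qed
qed auto

text \<open>If \<open>t\<close> has a pole, so must \<open>u\<close>; then \<open>u ^ q\<close> has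
  the strictly larger pole order and alone determines \<open>v t\<close>.\<close>

lemma v_artin_schreier:
  assumes "u ^ q + u = t" "t \<noteq> 0" "v t < 0" "q \<ge> 2"
  shows "u \<noteq> 0" and "v u < 0" and "int q * v u = v t"
proof -
  show u: "u \<noteq> 0" using assms by (auto simp: power_0_left)
  show neg: "v u < 0"
  proof (rule ccontr)
    assume "\<not> v u < 0"
    then have "min (v (u ^ q)) (v u) \<ge> 0" using u by (simp add: v_power)
    moreover have "min (v (u ^ q)) (v u) \<le> v t"
      using v_add[of "u ^ q" u] u assms by simp
    ultimately show False using assms by (simp add: min_def split: if_splits)
  qed
  have "v (u ^ q) < v u"
    using mult_strict_right_mono_neg[OF _ neg, of 1 "int q"] assms u by (simp add: v_power)
  then show "int q * v u = v t"
    using v_add_strict(2)[of "u ^ q" u] u assms by (simp add: v_power)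
qed

lemma v_artin_schreier_nonneg:
  assumes "u ^ q + u = t" "t \<noteq> 0 \<Longrightarrow> v t \<ge> 0" "q \<ge> 2"
  shows "v u \<ge> 0"
proof (rule ccontr)
  assume neg: "\<not> v u \<ge> 0"
  \<comment> \<open>The convention \<open>v 0 = 0\<close> excludes \<open>u = 0\<close>.\<close>
  then have u: "u \<noteq> 0" using v_0 by auto
  have "v (u ^ q) < v u"
    using mult_strict_right_mono_neg[of 1 "int q" "v u"] neg assms u by (simp add: v_power)
  then have "t \<noteq> 0" "v t = int q * v u"
    using v_add_strict[of "u ^ q" u] u assms(1) by (simp_all add: v_power)
  then show False
    using assms neg by (simp add: zero_le_mult_iff)
qed

end

lemma suz_wt_inj: "inj_on (suz_wt q0) (suz_expos q0)"
proof (rule inj_onI)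
  fix e e' assume ee: "e \<in> suz_expos q0" "e' \<in> suz_expos q0" "suz_wt q0 e = suz_wt q0 e'"
  obtain a b c d r a' b' c' d' r' where e: "e = (a, b, c, d, r)" "e' = (a', b', c', d', r')"
    by (metis prod_cases5)
  have bnd: "a < 2 * q0\<^sup>2" "b \<le> 1" "c < q0" "d < q0" "a' < 2 * q0\<^sup>2" "b' \<le> 1" "c' < q0" "d' < q0"
    using ee by (auto simp: e suz_expos_def)
  \<comment> \<open>The weight is a mixed-radix number: its digits to the bases q0, 2, q0, q (least significant first)
     are d, b, c + d, a + b + c + d with carries.\<close>
  have wt: "suz_wt q0 (a, b, c, d, r) = d + q0 * (b + 2 * (c + d + q0 * (a + b + c + d + 2 * q0\<^sup>2 * r)))"
    for a b c d r
    by (simp add: algebra_simps power2_eq_square)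
  have cancel: "i = i' \<and> n = n'" if "i + k * n = i' + k * n'" "i < k" "i' < k" for i i' k n n' :: nat
  proof -
    have "i = (i + k * n) mod k" "n = (i + k * n) div k"
      using that(2) by auto
    moreover have "i' = (i' + k * n') mod k" "n' = (i' + k * n') div k"
      using that(3) by auto
    ultimately show ?thesis using that(1) by metis
  qed
  have d: "d = d'" and 1: "b + 2 * (c + d + q0 * (a + b + c + d + 2 * q0\<^sup>2 * r)) =
      b' + 2 * (c' + d' + q0 * (a' + b' + c' + d' + 2 * q0\<^sup>2 * r'))"
    using cancel[of d q0 _ d'] ee(3) bnd unfolding e wt by blast+
  have b: "b = b'" and 2: "c + d + q0 * (a + b + c + d + 2 * q0\<^sup>2 * r) =
      c' + d' + q0 * (a' + b' + c' + d' + 2 * q0\<^sup>2 * r')"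
    using cancel[OF 1] bnd by auto
  have "c + q0 * (a + b + c + d + 2 * q0\<^sup>2 * r) = c' + q0 * (a' + b' + c' + d' + 2 * q0\<^sup>2 * r')"
    using 2 d by simp
  from cancel[OF this] bnd have c: "c = c'" and
    3: "a + b + c + d + 2 * q0\<^sup>2 * r = a' + b' + c' + d' + 2 * q0\<^sup>2 * r'"
    by auto
  have "a + 2 * q0\<^sup>2 * r = a' + 2 * q0\<^sup>2 * r'"
    using 3 b c d by simp
  from cancel[OF this] bnd show "e = e'"
    by (simp add: e b c d)
qed

section \<open>The function field of the curve and its values at a pole of x\<close>

locale suzuki =
  fixes m :: nat and \<iota> :: "'a::{field,finite} \<Rightarrow> 'b::field" and x y :: 'b and q0 :: nat
  assumes q0_def: "q0 = 2 ^ m"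
    and card: "card (UNIV :: 'a set) = 2 * q0\<^sup>2"
    and hom: "is_field_hom \<iota>"
    and gen: "generated_by \<iota> x y"
    and transc: "transcendental_over \<iota> x"
    and curve: "suz_rel q0 x y = 0"
begin

sublocale \<iota>: coeff_hom \<iota>
  by (rule field_hom_coeff_hom[OF hom])

lemma q0_pos: "q0 > 0"
  by (simp add: q0_def)

lemma q_ge_2: "2 * q0\<^sup>2 \<ge> 2"
  using q0_pos by simp

lemma char2_base: "CHAR('a) = 2"
proof -
  have "CHAR('a) dvd 2 ^ (2 * m + 1)"
    using CHAR_dvd_CARD[where 'a='a] card by (simp add: q0_def power_mult power2_eq_square power_mult_distrib flip: power_add mult_2)
  moreover have "CHAR('a) > 0"
    by (rule finite_imp_CHAR_pos) simp
  then have "prime CHAR('a)"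
    by (rule prime_CHAR_semidom)
  ultimately show ?thesis
    by (metis prime_dvd_power primes_dvd_imp_eq two_is_prime_nat)
qed

lemma char2: "CHAR('b) = 2"
proof (rule CHAR_eq_posI)
  have "\<iota> (1 + 1) = 0"
    by (simp only: add_self_CHAR_2[OF char2_base] \<iota>.hom_0)
  then have "1 + 1 = (0::'b)"
    by (simp only: \<iota>.hom_add \<iota>.hom_1)
  then show "of_nat 2 = (0::'b)"
    by simp
next
  fix n :: nat assume "n > 0" "n < 2"
  then show "of_nat n \<noteq> (0::'b)" by (simp add: less_2_cases_iff)
qed simp

abbreviation z where "z \<equiv> suz_z q0 x y"
abbreviation w where "w \<equiv> suz_w q0 x y"
abbreviation q where "q \<equiv> 2 * q0\<^sup>2"
abbreviation mon where "mon \<equiv> suz_mon q0 x y"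
abbreviation ev where "ev \<equiv> eval2 \<iota> x y"
abbreviation rel :: "'a poly poly" where "rel \<equiv> suz_rel q0 bvar_x bvar_y"

sublocale ev: coeff_hom ev
  by (rule \<iota>.eval2_hom)

lemma ev_rel [simp]: "ev rel = 0"
  by (simp add: curve)

lemma curve_eqs:
  "y ^ q + y = x ^ q0 * (x ^ q + x)"
  "z ^ q + z = x ^ (2 * q0) * (x ^ q + x)"
  "w ^ q + w = y ^ (2 * q0) * (x ^ q + x)"
  using curve suz_equations[OF char2 q0_def curve] by (simp_all add: suz_rel_def)

lemma ev_const_eq_0_iff [simp]: "ev [:s:] = 0 \<longleftrightarrow> s = 0"
  using transc unfolding \<iota>.eval2_const transcendental_over_def by auto

text \<open>The divisibility serves to find the kernel of \<open>ev\<close>, the equation to read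
  off values.\<close>

lemma ev_repr:
  obtains I \<gamma> where "finite I" "I \<subseteq> suz_expos q0" "\<And>e. e \<in> I \<Longrightarrow> \<gamma> e \<noteq> 0"
    "rel dvd P - (\<Sum>e\<in>I. [:[:\<gamma> e:]:] * suz_mon q0 bvar_x bvar_y e)"
    "ev P = (\<Sum>e\<in>I. \<iota> (\<gamma> e) * mon e)"
proof -
  obtain I \<gamma> where I: "finite I" "I \<subseteq> suz_expos q0"
    and dvd: "rel dvd P - (\<Sum>e\<in>I. [:[:\<gamma> e:]:] * suz_mon q0 bvar_x bvar_y e)"
    using suz_span_repr[OF char2_base q0_def suz_span_all[OF char2_base q0_def]] by blast
  \<comment> \<open>Zero coefficients are discarded, since every remaining term must have a
    well-defined pole order.\<close>
  define J where "J = {e\<in>I. \<gamma> e \<noteq> 0}"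
  have "(\<Sum>e\<in>I. [:[:\<gamma> e:]:] * suz_mon q0 bvar_x bvar_y e) =
      (\<Sum>e\<in>J. [:[:\<gamma> e:]:] * suz_mon q0 bvar_x bvar_y e)"
    by (rule sum.mono_neutral_right) (use I in \<open>auto simp: J_def\<close>)
  with dvd have dvd': "rel dvd P - (\<Sum>e\<in>J. [:[:\<gamma> e:]:] * suz_mon q0 bvar_x bvar_y e)"
    by simp
  then obtain D where D: "P - (\<Sum>e\<in>J. [:[:\<gamma> e:]:] * suz_mon q0 bvar_x bvar_y e) = rel * D" ..
  have "ev (P - (\<Sum>e\<in>J. [:[:\<gamma> e:]:] * suz_mon q0 bvar_x bvar_y e)) = 0"
    unfolding D ev.hom_mult ev_rel by simp
  then have "ev P = (\<Sum>e\<in>J. \<iota> (\<gamma> e) * mon e)"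
    by (simp del: mult_pCons_left)
  moreover have "finite J" "J \<subseteq> suz_expos q0" "\<And>e. e \<in> J \<Longrightarrow> \<gamma> e \<noteq> 0"
    using I by (auto simp: J_def)
  ultimately show ?thesis
    using that dvd' by blast
qed

end

context suzuki
begin

text \<open>The Artin-Schreier equations express the values of y, z and w through that of x, which
  makes them proportional to the weights. The factor \<open>k\<close> stays unknown for now; that it
  is 1 requires the normalization of \<open>v\<close> and a description of the whole field.\<close>

lemma infinite_place_values:
  assumes "is_place \<iota> v" "v x < 0"
  obtains k where "k > 0" "\<And>e. mon e \<noteq> 0" "\<And>e. v (mon e) = - k * int (suz_wt q0 e)"
proof -
  interpret place \<iota> v by unfold_locales (use hom assms in auto)
  let ?Q = "int q0"
  have x: "x \<noteq> 0" using assms v_0 by auto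
  have q: "int q = 2 * ?Q\<^sup>2" by simp
  have "1 < q" using q_ge_2 by linarith
  then have "1 < int q" by (metis of_nat_1 of_nat_less_iff)
  then have "v (x ^ q) < v x"
    using mult_strict_right_mono_neg[OF _ assms(2), of 1 "int q"] x by (simp add: v_power)
  then have u: "x ^ q + x \<noteq> 0" "v (x ^ q + x) = int q * v x"
    using v_add_strict[of "x ^ q" x] x by (simp_all add: v_power)
  have neg: "int n * v x + int q * v x < 0" for n
  proof -
    have "0 < n + q" using q_ge_2 by linarith
    then have "int (n + q) * v x < 0"
      by (intro mult_pos_neg assms) (simp only: of_nat_0_less_iff)
    then show ?thesis by (simp add: distrib_right)
  qed
  have "v (x ^ q0 * (x ^ q + x)) < 0"
    using neg[of q0] x u by (simp add: v_mult v_power)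
  note Y = v_artin_schreier[OF curve_eqs(1) _ this q_ge_2]
  have "v (x ^ (2 * q0) * (x ^ q + x)) < 0"
    using neg[of "2 * q0"] x u by (simp add: v_mult v_power)
  note Z = v_artin_schreier[OF curve_eqs(2) _ this q_ge_2]
  have y: "y \<noteq> 0" "v y < 0" "int q * v y = (?Q + int q) * v x"
    using Y x u by (simp_all add: v_mult v_power distrib_right)
  have z: "z \<noteq> 0" "int q * v z = (2 * ?Q + int q) * v x"
    using Z x u by (simp_all add: v_mult v_power distrib_right)
  have "2 * ?Q * v y + int q * v x < 0"
  proof (rule add_nonpos_neg)
    show "2 * ?Q * v y \<le> 0" using y by (intro mult_nonneg_nonpos) auto
    show "int q * v x < 0" using neg[of 0] by simp
  qed
  then have "v (y ^ (2 * q0) * (x ^ q + x)) < 0"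
    using y u by (simp add: v_mult v_power)
  note W = v_artin_schreier[OF curve_eqs(3) _ this q_ge_2]
  have w: "w \<noteq> 0" "int q * v w = 2 * ?Q * v y + int q * v x"
    using W y u by (simp_all add: v_mult v_power)
  have Q: "?Q > 0" using q0_pos by simp
  \<comment> \<open>With 2 q0^2 = q and q0 (2 q0 + 1) = q0 + q, this is the equation for q v(y)
    multiplied out; the factor q0 then cancels.\<close>
  have "?Q * (2 * ?Q * v y) = ?Q * ((2 * ?Q + 1) * v x)"
    using y(3) by (simp add: q algebra_simps power2_eq_square)
  then have y2: "2 * ?Q * v y = (2 * ?Q + 1) * v x"
    using Q by simp
  \<comment> \<open>Since (2 q0 - 1)(2 q0 + 1) = 2 q - 1, the equation for v w exhibits v x as a multiple of q.\<close>
  define k where "k = (2 * ?Q - 1) * (v w - v x) - 2 * v x"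
  have "(2 * ?Q - 1) * (int q * (v w - v x)) = (2 * ?Q - 1) * ((2 * ?Q + 1) * v x)"
    using w(2) y2 by (simp add: algebra_simps)
  then have vx: "v x = - (k * int q)"
    by (simp add: k_def q algebra_simps power2_eq_square)
  have cancel: "a = b" if "int q * a = int q * b" for a b :: int
    using that q0_pos by simp
  have vy: "v y = - (k * (int q + ?Q))"
    by (rule cancel) (simp only: y(3) vx, simp add: algebra_simps)
  have vz: "v z = - (k * (int q + 2 * ?Q))"
    by (rule cancel) (simp only: z(2) vx, simp add: algebra_simps)
  have vw: "v w = - (k * (int q + 2 * ?Q + 1))"
    by (rule cancel) (simp only: w(2) y2 vx, simp add: algebra_simps)
  have k: "k > 0"
    using assms(2) q0_pos unfolding vx by (simp add: zero_less_mult_iff)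
  have mon: "mon e \<noteq> 0 \<and> v (mon e) = - k * int (suz_wt q0 e)" for e
  proof (cases e)
    case (fields a b c d r)
    have "v (mon e) = int a * v x + int b * v y + int c * v z + int d * v w + int r * (int q * v x)"
      unfolding fields suz_mon.simps using x y(1) z(1) w(1) u by (simp add: v_mult v_power)
    also have "\<dots> = - k * int (suz_wt q0 e)"
      unfolding vx vy vz vw fields suz_wt.simps by (simp add: algebra_simps power2_eq_square)
    finally show ?thesis
      unfolding fields suz_mon.simps using x y(1) z(1) w(1) u by simp
  qed
  show thesis
    by (rule that[OF k]) (use mon in auto)
qed

text \<open>Weights are distinct on \<open>suz_expos\<close>, so \<open>v_sum\<close> applies; the
  factor \<open>- k\<close> reverses the order and turns the minimum of values into the maximum of
  weights.\<close>

lemma infinite_place_sum: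
  assumes v: "is_place \<iota> v"
    and k: "k > 0" "\<And>e. mon e \<noteq> 0" "\<And>e. v (mon e) = - k * int (suz_wt q0 e)"
    and I: "finite I" "I \<noteq> {}" "I \<subseteq> suz_expos q0" "\<And>e. e \<in> I \<Longrightarrow> \<gamma> e \<noteq> 0"
  shows "(\<Sum>e\<in>I. \<iota> (\<gamma> e) * mon e) \<noteq> 0"
    and "v (\<Sum>e\<in>I. \<iota> (\<gamma> e) * mon e) = - k * int (Max (suz_wt q0 ` I))"
proof -
  interpret place \<iota> v by unfold_locales (use hom v in auto)
  let ?f = "\<lambda>e. \<iota> (\<gamma> e) * mon e"
  have nz: "\<iota> c \<noteq> 0" if "c \<noteq> 0" for c
    using that \<iota>.hom_mult[of c "inverse c"] by auto
  have vf: "v (?f e) = - k * int (suz_wt q0 e)" if "e \<in> I" for e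
    using that nz I(4) k v_const by (simp add: v_mult)
  have "inj_on (v \<circ> ?f) I"
  proof (rule inj_onI)
    fix e e' assume e: "e \<in> I" "e' \<in> I" "(v \<circ> ?f) e = (v \<circ> ?f) e'"
    then have "suz_wt q0 e = suz_wt q0 e'"
      using k(1) by (simp add: vf)
    then show "e = e'"
      using e I(3) suz_wt_inj[of q0] by (auto dest: inj_onD)
  qed
  then have s: "sum ?f I \<noteq> 0 \<and> v (sum ?f I) = Min ((v \<circ> ?f) ` I)"
    using I nz k(2) by (intro v_sum) auto
  then show "sum ?f I \<noteq> 0" by simp
  have "(v \<circ> ?f) ` I = (\<lambda>n. - k * int n) ` (suz_wt q0 ` I)"
    unfolding image_image by (rule image_cong) (simp_all add: vf)
  also have "Min \<dots> = - k * int (Max (suz_wt q0 ` I))"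
  proof (rule Min_eqI)
    show "- k * int (Max (suz_wt q0 ` I)) \<in> (\<lambda>n. - k * int n) ` suz_wt q0 ` I"
      by (intro imageI Max_in) (use I in auto)
    fix t assume "t \<in> (\<lambda>n. - k * int n) ` suz_wt q0 ` I"
    then obtain n where n: "n \<in> suz_wt q0 ` I" "t = - k * int n" by blast
    then show "- k * int (Max (suz_wt q0 ` I)) \<le> t"
      using I k(1) Max_ge[of "suz_wt q0 ` I" n] by simp
  qed (use I in auto)
  finally show "v (sum ?f I) = - k * int (Max (suz_wt q0 ` I))"
    using s by simp
qed

lemma degree_rel: "degree rel = q" and lead_coeff_rel: "lead_coeff rel = 1"
proof -
  have rel: "rel = monom 1 q + ([:0, 1:] - [:[:0, 1:] ^ q0 * ([:0, 1:] ^ q + [:0, 1:]):])"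
    by (simp add: suz_rel_def monom_altdef algebra_simps poly_const_pow)
  have lt: "degree ([:0, 1:] - [:[:0, 1:] ^ q0 * ([:0, 1:] ^ q + [:0, 1:]) :: 'a poly:]) < q"
    using q_ge_2 by (intro le_less_trans[OF degree_diff_le[of _ 1]]) auto
  then show d: "degree rel = q"
    unfolding rel by (subst degree_add_eq_left) (simp_all add: degree_monom_eq)
  show "lead_coeff rel = 1"
    unfolding d using lt by (simp add: rel coeff_eq_0)
qed

end

section \<open>The coordinate ring, fractions, and uniqueness of the place at infinity\<close>

locale suzuki_infinite = suzuki m \<iota> x y q0
  for m :: nat and \<iota> :: "'a::{field,finite} \<Rightarrow> 'b::field" and x y :: 'b and q0 :: nat +
  fixes Pinf :: "'b \<Rightarrow> int"
  assumes Pinf: "is_place \<iota> Pinf" and Pinf_x: "Pinf x < 0"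
begin

text \<open>The place \<open>Pinf\<close> makes the monomials independent, so an element of the
  kernel has an empty representation and is congruent to 0 modulo \<open>rel\<close>.\<close>

lemma ev_eq_0_iff: "ev P = 0 \<longleftrightarrow> rel dvd P"
proof
  assume "rel dvd P"
  then obtain D where "P = rel * D" ..
  then show "ev P = 0"
    by (simp only: ev.hom_mult ev_rel mult_zero_left)
next
  assume 0: "ev P = 0"
  obtain I \<gamma> where I: "finite I" "I \<subseteq> suz_expos q0" "\<And>e. e \<in> I \<Longrightarrow> \<gamma> e \<noteq> 0"
    and dvd: "rel dvd P - (\<Sum>e\<in>I. [:[:\<gamma> e:]:] * suz_mon q0 bvar_x bvar_y e)"
    and P: "ev P = (\<Sum>e\<in>I. \<iota> (\<gamma> e) * mon e)"
    by (rule ev_repr[of P]) blast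
  obtain k where k: "k > 0" "\<And>e. mon e \<noteq> 0" "\<And>e. Pinf (mon e) = - k * int (suz_wt q0 e)"
    by (rule infinite_place_values[OF Pinf Pinf_x]) blast
  have "I = {}"
    using infinite_place_sum(1)[OF Pinf k I(1) _ I(2,3)] 0 P by fastforce
  then show "rel dvd P"
    using dvd by simp
qed

lemma ev_nonzero:
  assumes "P \<noteq> 0" "degree P < q"
  shows "ev P \<noteq> 0"
  using dvd_imp_degree_le[of rel P] assms degree_rel by (auto simp: ev_eq_0_iff)

text \<open>Euclid's algorithm applied to P and the minimal polynomial of y, with denominators cleared.\<close>
lemma ev_divides_const:
  assumes "P \<noteq> 0" "degree P < q"
  shows "\<exists>U a. a \<noteq> 0 \<and> ev (U * P) = ev [:a:]"
  using assms
proof (induction "degree P" arbitrary: P rule: less_induct)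
  case less
  show ?case
  proof (cases "degree P = 0")
    case True
    then obtain a where "P = [:a:]" by (rule degree_eq_zeroE)
    then show ?thesis
      using less.prems by (intro exI[of _ 1] exI[of _ a]) auto
  next
    case False
    obtain D S where DS: "pseudo_divmod rel P = (D, S)" by force
    define l where "l = lead_coeff P ^ (Suc (degree rel) - degree P)"
    have l: "l \<noteq> 0" using less.prems by (simp add: l_def)
    have eq: "smult l rel = P * D + S" and S: "S = 0 \<or> degree S < degree P"
      using pseudo_divmod[OF less.prems(1) DS] by (simp_all add: l_def)
    have "smult l rel = [:l:] * rel" by simp
    with eq have "ev (P * D + S) = 0"
      by (metis ev.hom_mult ev_rel mult_zero_right)
    then have PDS: "ev P * ev D + ev S = 0"
      by (simp only: ev.hom_add ev.hom_mult)
    \<comment> \<open>Otherwise \<open>P * D\<close> is a nonzero multiple of \<open>rel\<close> of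
      degree q. As \<open>P\<close> has positive degree, \<open>D\<close> has degree below q, so
      neither factor vanishes at (x, y), although their product does.\<close>
    have "S \<noteq> 0"
    proof
      assume "S = 0"
      then have "smult l rel = P * D" using eq by simp
      moreover have "smult l rel \<noteq> 0" using l lead_coeff_rel by auto
      ultimately have nz: "D \<noteq> 0" and "degree (smult l rel) = degree P + degree D"
        using less.prems by (auto simp: degree_mult_eq)
      then have "degree D < q"
        using False l degree_rel by simp
      then show False
        using ev_nonzero[OF nz] ev_nonzero[OF less.prems] PDS \<open>S = 0\<close> by simp
    qed
    moreover have "degree S < degree P" using S calculation by simp
    ultimately obtain U a where "a \<noteq> 0" "ev (U * S) = ev [:a:]"
      using less.hyps[of S] less.prems by auto
    moreover have "ev (- U * D * P) = ev U * ev S"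
    proof -
      have "ev S = - (ev P * ev D)"
        using PDS by (simp add: eq_neg_iff_add_eq_0 add.commute)
      then show ?thesis
        by (simp only: ev.hom_mult ev.hom_minus) simp
    qed
    ultimately show ?thesis
      by (metis ev.hom_mult)
  qed
qed

text \<open>\<open>rel\<close> is monic in y, so pseudo-division by it brings in no extra
  factor.\<close>

lemma ev_reduce:
  obtains R where "degree R < q" "ev R = ev P"
proof -
  have nz: "rel \<noteq> 0" using lead_coeff_rel by auto
  obtain D R where DR: "pseudo_divmod P rel = (D, R)" by force
  have "P = rel * D + R" "R = 0 \<or> degree R < degree rel"
    using pseudo_divmod[OF nz DR] by (simp_all add: lead_coeff_rel)
  then have "degree R < q" "ev P = ev R"
    using q_ge_2 degree_rel ev_rel by (auto simp only: ev.hom_add ev.hom_mult degree_0) auto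
  then show ?thesis using that by metis
qed

text \<open>The fractions with denominator in x alone form a subfield containing the generators. For
  inverses, a multiple \<open>U\<close> turns the numerator into a polynomial \<open>a\<close> in x,
  and the inverse of P/s becomes U s / a.\<close>

lemma fraction:
  obtains P s where "s \<noteq> 0" "f * ev [:s:] = ev P"
proof -
  define K where "K = {f. \<exists>P s. s \<noteq> 0 \<and> f * ev [:s:] = ev P}"
  have KI: "f \<in> K" if "s \<noteq> 0" "f * ev [:s:] = ev P" for f s P
    using that unfolding K_def by blast
  have ev_mult: "ev [:s * t:] = ev [:s:] * ev [:t:]" for s t
    using ev.hom_mult[of "[:s:]" "[:t:]"] by (simp add: mult.commute)
  have evK: "ev P \<in> K" for P
    using KI[of 1 "ev P" P] ev.hom_1 by (simp flip: one_pCons)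
  have "is_subfield K"
    unfolding is_subfield_def
  proof (intro conjI ballI)
    show "0 \<in> K" "1 \<in> K" using evK[of 0] evK[of 1] by auto
    fix f assume f: "f \<in> K"
    then obtain P s where Ps: "s \<noteq> 0" "f * ev [:s:] = ev P" unfolding K_def by blast
    show "- f \<in> K" using KI[of s "- f" "- P"] Ps by simp
    show "inverse f \<in> K"
    proof (cases "f = 0")
      case True
      then show ?thesis using \<open>0 \<in> K\<close> by simp
    next
      case False
      obtain R where R: "degree R < q" "ev R = ev P" by (rule ev_reduce)
      have "ev P \<noteq> 0" using Ps(1) False by (simp flip: Ps(2))
      then have "R \<noteq> 0" using R(2) by auto
      then obtain U a where U: "a \<noteq> 0" "ev (U * R) = ev [:a:]"
        using ev_divides_const R(1) by blast
      have "inverse f * ev [:a:] = ev U * ev [:s:]"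
        unfolding U(2)[symmetric] ev.hom_mult R(2) Ps(2)[symmetric] using False by simp
      then show ?thesis
        using KI[OF U(1), of _ "U * [:s:]"] by (simp only: ev.hom_mult)
    qed
    fix g assume "g \<in> K"
    then obtain Q t where Qt: "t \<noteq> 0" "g * ev [:t:] = ev Q" unfolding K_def by blast
    have st: "s * t \<noteq> 0" using Ps Qt by simp
    show "f + g \<in> K"
      by (rule KI[OF st, of _ "P * [:t:] + Q * [:s:]"])
        (simp only: ev_mult ev.hom_add ev.hom_mult Ps(2)[symmetric] Qt(2)[symmetric], simp add: algebra_simps)
    show "f * g \<in> K"
      by (rule KI[OF st, of _ "P * Q"])
        (simp only: ev_mult ev.hom_mult Ps(2)[symmetric] Qt(2)[symmetric], simp add: algebra_simps)
  qed
  moreover have "range \<iota> \<subseteq> K" using evK[of "[:[:c:]:]" for c] by auto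
  moreover have "x \<in> K" "y \<in> K" using evK[of bvar_x] evK[of bvar_y] by simp_all
  ultimately have "K = UNIV"
    using gen unfolding generated_by_def by blast
  then have "f \<in> K" by simp
  then show ?thesis using that unfolding K_def by blast
qed

text \<open>All values on the coordinate ring are multiples of \<open>k\<close>, hence so are those
  of fractions; an element of value 1 then forces \<open>k = 1\<close>.\<close>

lemma infinite_place_normalized:
  assumes v: "is_place \<iota> v" "v x < 0"
  shows "mon e \<noteq> 0" and "v (mon e) = - int (suz_wt q0 e)"
proof -
  interpret place \<iota> v by unfold_locales (use hom v in auto)
  obtain k where k: "k > 0" "\<And>e. mon e \<noteq> 0" "\<And>e. v (mon e) = - k * int (suz_wt q0 e)"
    by (rule infinite_place_values[OF v]) blast
  have dvd: "k dvd v (ev P)" if "ev P \<noteq> 0" for P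
  proof -
    obtain I \<gamma> where I: "finite I" "I \<subseteq> suz_expos q0" "\<And>e. e \<in> I \<Longrightarrow> \<gamma> e \<noteq> 0"
      and dvd: "rel dvd P - (\<Sum>e\<in>I. [:[:\<gamma> e:]:] * suz_mon q0 bvar_x bvar_y e)"
      and P: "ev P = (\<Sum>e\<in>I. \<iota> (\<gamma> e) * mon e)"
      by (rule ev_repr[of P]) blast
    have "I \<noteq> {}" using that P by auto
    then show ?thesis
      using infinite_place_sum(2)[OF v(1) k I(1) _ I(2,3)] P by simp
  qed
  obtain t where t: "t \<noteq> 0" "v t = 1"
    using place by (auto simp: is_place_def)
  obtain P s where Ps: "s \<noteq> 0" "t * ev [:s:] = ev P" by (rule fraction)
  have nz: "ev P \<noteq> 0" using Ps t by (simp flip: Ps(2))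
  have "v (ev P) = 1 + v (ev [:s:])"
    using Ps t v_mult[of t "ev [:s:]"] by simp
  moreover have "k dvd v (ev P)" "k dvd v (ev [:s:])"
    using dvd nz Ps by auto
  ultimately have "k dvd 1" by (metis dvd_add_left_iff)
  then have "k = 1" using k(1) by simp
  then show "mon e \<noteq> 0" "v (mon e) = - int (suz_wt q0 e)"
    using k by simp_all
qed

text \<open>Values on the coordinate ring are dictated by the weights, and every function is a
  fraction of such elements.\<close>

lemma infinite_place_unique:
  assumes v: "is_place \<iota> v" "v x < 0"
  shows "v = Pinf"
proof
  interpret V: place \<iota> v by unfold_locales (use hom v in auto)
  interpret P: place \<iota> Pinf by unfold_locales (use hom Pinf in auto)
  have eq: "v (ev P) = Pinf (ev P)" for P
  proof -
    obtain I \<gamma> where I: "finite I" "I \<subseteq> suz_expos q0" "\<And>e. e \<in> I \<Longrightarrow> \<gamma> e \<noteq> 0"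
      and dvd: "rel dvd P - (\<Sum>e\<in>I. [:[:\<gamma> e:]:] * suz_mon q0 bvar_x bvar_y e)"
      and P: "ev P = (\<Sum>e\<in>I. \<iota> (\<gamma> e) * mon e)"
      by (rule ev_repr[of P]) blast
    show ?thesis
    proof (cases "I = {}")
      case True
      then show ?thesis using P V.v_0 P.v_0 by simp
    next
      case False
      have *: "u (ev P) = - 1 * int (Max (suz_wt q0 ` I))" if "is_place \<iota> u" "u x < 0" for u
        unfolding P using infinite_place_normalized[OF that]
        by (intro infinite_place_sum(2) that I False) auto
      show ?thesis using *[OF v] *[OF Pinf Pinf_x] by simp
    qed
  qed
  fix f
  obtain P s where Ps: "s \<noteq> 0" "f * ev [:s:] = ev P" by (rule fraction)
  show "v f = Pinf f"
  proof (cases "f = 0")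
    case False
    have "v f + v (ev [:s:]) = v (ev P)" "Pinf f + Pinf (ev [:s:]) = Pinf (ev P)"
      using Ps False V.v_mult P.v_mult by (simp_all flip: Ps(2))
    then show ?thesis by (simp add: eq)
  qed (simp add: V.v_0 P.v_0)
qed

text \<open>By uniqueness x has no pole at \<open>v\<close>; the Artin-Schreier equations pass this
  on to y, z and w in turn.\<close>

lemma finite_place_mon:
  assumes v: "is_place \<iota> v" "v \<noteq> Pinf"
  shows "v (mon e) \<ge> 0"
proof -
  interpret place \<iota> v by unfold_locales (use hom v in auto)
  have x: "v x \<ge> 0"
    using infinite_place_unique v by force
  have nn: "v (a * b) \<ge> 0" if "v a \<ge> 0" "v b \<ge> 0" for a b
    using that v_mult[of a b] v_0 by (cases "a = 0 \<or> b = 0") auto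
  have pw: "v (a ^ n) \<ge> 0" if "v a \<ge> 0" for a n
    using that by (induction n) (simp_all add: v_1 nn)
  have ad: "v (a + b) \<ge> 0" if "v a \<ge> 0" "v b \<ge> 0" for a b
  proof (cases "a = 0 \<or> b = 0 \<or> a + b = 0")
    case False
    then show ?thesis using that v_add[of a b] by simp
  qed (use that v_0 in auto)
  have u: "v (x ^ q + x) \<ge> 0" using x pw ad by blast
  have y: "v y \<ge> 0"
    by (rule v_artin_schreier_nonneg[OF curve_eqs(1) _ q_ge_2]) (intro nn pw x u)
  have z: "v z \<ge> 0"
    by (rule v_artin_schreier_nonneg[OF curve_eqs(2) _ q_ge_2]) (intro nn pw x u)
  have w: "v w \<ge> 0"
    by (rule v_artin_schreier_nonneg[OF curve_eqs(3) _ q_ge_2]) (intro nn pw y u)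
  show ?thesis
    by (cases e) (simp only: suz_mon.simps, intro nn pw x y z w u)
qed

end

section \<open>Places at the affine points\<close>

lemma fps_artin_schreier:
  fixes H :: "'c::field fps"
  assumes char2: "CHAR('c) = 2" and q: "q = 2 ^ Suc n" and \<beta>: "\<beta> ^ q + \<beta> = fps_nth H 0"
  obtains S where "S ^ q + S = H" "fps_nth S 0 = \<beta>"
proof -
  have q2: "q \<ge> 2" by (simp add: q)
  define u :: "'c fps" where "u = fps_X + fps_X ^ q"
  define g where "g = H - fps_const (fps_nth H 0)"
  \<comment> \<open>X + X^q has a compositional inverse, which solves the equation for the part of
    \<open>H\<close> without constant term; the constant term is left to
    \<open>\<beta>\<close>.\<close>
  define \<delta> where "\<delta> = fps_inv u oo g"
  have u: "fps_nth u 0 = 0" "fps_nth u 1 \<noteq> 0"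
    using q2 by (auto simp: u_def fps_X_power_nth)
  have g: "fps_nth g 0 = 0" by (simp add: g_def)
  have inv0: "fps_nth (fps_inv u) 0 = 0" by (simp add: fps_inv_def)
  then have \<delta>: "fps_nth \<delta> 0 = 0" by (simp add: \<delta>_def)
  have "\<delta> + \<delta> ^ q = u oo \<delta>"
    using \<delta> by (simp add: u_def fps_compose_add_distrib flip: fps_compose_power)
  also have "\<dots> = (u oo fps_inv u) oo g"
    unfolding \<delta>_def by (rule fps_compose_assoc[OF g inv0])
  also have "\<dots> = g"
    using g by (simp add: fps_inv_right[OF u])
  finally have \<delta>eq: "\<delta> + \<delta> ^ q = g" .
  have "CHAR('c fps) = 2" using char2 by simp
  from add_power_CHAR_2[OF this, of "fps_const \<beta>" \<delta> "Suc n"]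
  have "(fps_const \<beta> + \<delta>) ^ q + (fps_const \<beta> + \<delta>) = fps_const (\<beta> ^ q + \<beta>) + (\<delta> + \<delta> ^ q)"
    by (simp add: q fps_const_power fps_const_add[symmetric] del: fps_const_add)
  also have "\<dots> = H"
    unfolding \<delta>eq \<beta> by (simp add: g_def)
  finally show ?thesis
    using that[of "fps_const \<beta> + \<delta>"] \<delta> by simp
qed

text \<open>The least positive value \<open>n\<close> generates the value group, so division by
  \<open>n\<close> gives a normalized valuation with the same signs.\<close>

lemma normalize_valuation:
  fixes val :: "'b::field \<Rightarrow> int" and \<iota> :: "'a::field \<Rightarrow> 'b"
  assumes val_0: "val 0 = 0"
    and val_mult: "\<And>a b. a \<noteq> 0 \<Longrightarrow> b \<noteq> 0 \<Longrightarrow> val (a * b) = val a + val b"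
    and val_add: "\<And>a b. a \<noteq> 0 \<Longrightarrow> b \<noteq> 0 \<Longrightarrow> a + b \<noteq> 0 \<Longrightarrow> min (val a) (val b) \<le> val (a + b)"
    and val_const: "\<And>c. c \<noteq> 0 \<Longrightarrow> val (\<iota> c) = 0"
    and pos: "g \<noteq> 0" "val g > 0"
  obtains v e where "is_place \<iota> v" "e > 0" "\<And>f. val f = e * v f"
proof -
  define n where "n = (LEAST n::nat. n > 0 \<and> (\<exists>f. f \<noteq> 0 \<and> val f = int n))"
  have "\<exists>n::nat. n > 0 \<and> (\<exists>f. f \<noteq> 0 \<and> val f = int n)"
    using pos by (intro exI[of _ "nat (val g)"]) auto
  then have "n > 0 \<and> (\<exists>f. f \<noteq> 0 \<and> val f = int n)"
    unfolding n_def by (rule LeastI_ex)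
  then obtain t where n: "n > 0" and t: "t \<noteq> 0" "val t = int n" by blast
  have least: "n \<le> k" if "k > 0" "f \<noteq> 0" "val f = int k" for k f
    unfolding n_def by (rule Least_le) (use that in blast)
  have val_1: "val 1 = 0" using val_mult[of 1 1] by simp
  have val_inv: "val (inverse a) = - val a" if "a \<noteq> 0" for a
    using val_mult[of a "inverse a"] that val_1 by simp
  have val_power: "val (a ^ k) = int k * val a" if "a \<noteq> 0" for a k
    using that by (induction k) (simp_all add: val_1 val_mult algebra_simps)
  have val_powi: "val (t powi d) = d * int n" for d
    using t by (simp add: power_int_def val_power val_inv)
  have dvd: "int n dvd val f" for f
  proof (cases "f = 0")
    case False
    \<comment> \<open>Dividing by the d-th power of \<open>t\<close> leaves a value in [0, n), which
      minimality of \<open>n\<close> forces to be 0.\<close>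
    define d where "d = val f div int n"
    have "val (f * t powi (- d)) = val f - d * int n"
      using False t val_mult[of f "t powi (- d)"] val_powi[of "- d"] by simp
    also have "\<dots> = val f mod int n"
      by (simp add: d_def minus_div_mult_eq_mod)
    finally have eq: "val (f * t powi (- d)) = val f mod int n" .
    have nn: "val f mod int n \<ge> 0" "val f mod int n < int n" using n by auto
    have "val f mod int n = 0"
    proof (rule ccontr)
      assume "val f mod int n \<noteq> 0"
      then have "n \<le> nat (val f mod int n)"
        using nn eq False t by (intro least[of _ "f * t powi (- d)"]) auto
      then show False using nn n by linarith
    qed
    then show ?thesis by auto
  qed (simp add: val_0)
  define v where "v f = val f div int n" for f
  have eq: "val f = int n * v f" for f
    using dvd by (simp add: v_def)
  have "is_place \<iota> v"
    unfolding is_place_def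
  proof (intro conjI allI impI)
    show "v 0 = 0" by (simp add: v_def val_0)
    show "\<exists>t. t \<noteq> 0 \<and> v t = 1" using t n by (intro exI[of _ t]) (simp add: v_def)
    fix a b :: 'b assume ab: "a \<noteq> 0" "b \<noteq> 0"
    have "int n * v (a * b) = int n * (v a + v b)"
      using val_mult[OF ab] by (simp add: eq distrib_left)
    then show "v (a * b) = v a + v b" using n by simp
    assume "a + b \<noteq> 0"
    then show "min (v a) (v b) \<le> v (a + b)"
      using val_add[OF ab] n by (simp add: eq min_def split: if_splits)
  qed (simp add: v_def val_const)
  then show ?thesis
    using that[of v "int n"] n eq by simp
qed

lemma hom_eval2:
  assumes "coeff_hom j" "coeff_hom k"
  shows "j (eval2 k u t P) = eval2 (j \<circ> k) (j u) (j t) P"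
proof -
  interpret j: coeff_hom j by fact
  interpret k: coeff_hom k by fact
  interpret jk: coeff_hom "j \<circ> k" by (rule coeff_hom.intro) simp_all
  interpret e: coeff_hom "eval2 k u t" by (rule k.eval2_hom)
  interpret e': coeff_hom "eval2 (j \<circ> k) (j u) (j t)" by (rule jk.eval2_hom)
  show ?thesis
  proof (induction P rule: bipoly_induct)
    case (const a)
    show ?case by (metis comp_apply k.eval2_simps(1) jk.eval2_simps(1))
  next
    case (add P Q)
    then show ?case by (simp only: e.hom_add e'.hom_add j.hom_add)
  next
    case (mult_x P)
    then show ?case
      by (simp only: e.hom_mult e'.hom_mult j.hom_mult k.eval2_simps jk.eval2_simps)
  next
    case (mult_y P)
    then show ?case
      by (simp only: e.hom_mult e'.hom_mult j.hom_mult k.eval2_simps jk.eval2_simps)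
  qed
qed

lemma coeff_hom_to_ac: "coeff_hom (to_ac :: 'a::field \<Rightarrow> _)"
  by (rule coeff_hom.intro) simp_all

lemma coeff_hom_fps_nth_0: "coeff_hom (\<lambda>f::'c::comm_ring_1 fps. fps_nth f 0)"
  by (rule coeff_hom.intro) simp_all

text \<open>Writes the expansion of a polynomial in x at \<alpha> as a shifted polynomial, so that
  nonzero polynomials have nonzero expansions.\<close>

lemma poly_translate_fps:
  fixes \<alpha> :: "'c::idom"
  shows "poly (map_poly fps_const p) (fps_const \<alpha> + fps_X) = fps_of_poly (pcompose p [:\<alpha>, 1:])"
proof (induction p)
  case (pCons a p)
  have "fps_of_poly [:\<alpha>, 1:] = fps_const \<alpha> + fps_X"
    by (simp add: fps_of_poly_pCons fps_of_poly_const)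
  then show ?case
    using pCons by (simp add: map_poly_pCons pcompose_pCons fps_of_poly_add fps_of_poly_mult fps_of_poly_const)
qed simp

context suzuki_infinite
begin

text \<open>The order of vanishing of power series expansions at (\<alpha>, \<beta>), in the
  parameter x - \<alpha>, is a valuation. The last property says that a regular fraction whose
  denominator vanishes at the point has a vanishing numerator there.\<close>

lemma finite_place_exists:
  fixes \<alpha> \<beta> :: "'a alg_closure"
  assumes \<alpha>\<beta>: "suz_rel q0 \<alpha> \<beta> = 0" and s: "s \<noteq> 0" "poly (map_poly to_ac s) \<alpha> = 0"
  obtains v where "is_place \<iota> v" "v x \<ge> 0"
    "\<And>f P. f \<noteq> 0 \<Longrightarrow> f * ev [:s:] = ev P \<Longrightarrow> v f \<ge> 0 \<Longrightarrow> eval2 to_ac \<alpha> \<beta> P = 0"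
proof -
  have c: "coeff_hom (fps_const \<circ> to_ac :: 'a \<Rightarrow> _)"
    by (rule coeff_hom.intro) simp_all
  have q: "q = 2 ^ Suc (2 * m)" unfolding q0_def by (simp add: power_even_eq)
  define T :: "'a alg_closure fps" where "T = fps_const \<alpha> + fps_X"
  have T0: "fps_nth T 0 = \<alpha>" by (simp add: T_def)
  have "\<beta> ^ q + \<beta> = fps_nth (T ^ q0 * (T ^ q + T)) 0"
    using \<alpha>\<beta> by (simp add: T0 suz_rel_def coeff_hom.hom_power[OF coeff_hom_fps_nth_0])
  moreover have "CHAR('a alg_closure) = 2" using char2_base by simp
  ultimately obtain S where S: "S ^ q + S = T ^ q0 * (T ^ q + T)" "fps_nth S 0 = \<beta>"
    using fps_artin_schreier[OF _ q] by blast
  \<comment> \<open>The expansion at (\<alpha>, \<beta>). It kills \<open>rel\<close>, so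
    \<open>\<phi> P\<close> depends only on the function \<open>ev P\<close>.\<close>
  define \<phi> where "\<phi> = eval2 (fps_const \<circ> to_ac :: 'a \<Rightarrow> _) T S"
  interpret \<phi>: coeff_hom \<phi> unfolding \<phi>_def by (rule coeff_hom.eval2_hom[OF c])
  have \<phi>_rel: "\<phi> rel = 0"
    unfolding \<phi>.hom_suz using S(1) by (simp add: suz_rel_def) (simp add: \<phi>_def coeff_hom.eval2_simps[OF c])
  have \<phi>_0: "fps_nth (\<phi> P) 0 = eval2 to_ac \<alpha> \<beta> P" for P
    using hom_eval2[OF coeff_hom_fps_nth_0 c, of T S P] by (simp add: \<phi>_def T0 S(2) o_def)
  have \<phi>_const: "\<phi> [:p:] \<noteq> 0" if "p \<noteq> 0" for p
  proof -
    have "\<phi> [:p:] = poly (map_poly fps_const (map_poly to_ac p)) T"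
      unfolding \<phi>_def coeff_hom.eval2_const[OF c] by (simp add: map_poly_map_poly)
    also have "\<dots> = fps_of_poly (pcompose (map_poly to_ac p) [:\<alpha>, 1:])"
      unfolding T_def by (rule poly_translate_fps)
    also have "\<dots> \<noteq> 0"
    proof
      assume "fps_of_poly (pcompose (map_poly to_ac p) [:\<alpha>, 1:]) = 0"
      then have "pcompose (map_poly to_ac p) [:\<alpha>, 1:] = 0"
        by (metis fps_of_poly_0 fps_of_poly_eq_iff)
      then have "map_poly to_ac p = 0"
        by (rule pcompose_eq_0) simp
      then show False
        using that by (simp add: map_poly_eq_0_iff)
    qed
    finally show ?thesis .
  qed
  have \<phi>_cong: "\<phi> P = \<phi> P'" if "ev P = ev P'" for P P'
  proof -
    have "rel dvd P - P'" using that by (simp flip: ev_eq_0_iff)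
    then obtain D where "P - P' = rel * D" ..
    then have "\<phi> (P - P') = 0" by (simp only: \<phi>.hom_mult \<phi>_rel mult_zero_left)
    then show ?thesis by simp
  qed
  \<comment> \<open>A multiple of the reduced representative equals a nonzero polynomial in x, whose
    expansion is nonzero by \<open>\<phi>_const\<close>.\<close>
  have \<phi>_nz: "\<phi> P \<noteq> 0" if "ev P \<noteq> 0" for P
  proof -
    obtain R where R: "degree R < q" "ev R = ev P" by (rule ev_reduce)
    have "R \<noteq> 0" using that R by auto
    then obtain U a where U: "a \<noteq> 0" "ev (U * R) = ev [:a:]"
      using ev_divides_const R(1) by blast
    have "\<phi> U * \<phi> R \<noteq> 0"
      using \<phi>_cong[OF U(2)] \<phi>_const[OF U(1)] by (simp only: \<phi>.hom_mult) simp
    then show ?thesis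
      using \<phi>_cong[OF R(2)] by auto
  qed
  define sd where "sd P = int (subdegree (\<phi> P))" for P
  have sd_mult: "sd (P * Q) = sd P + sd Q" if "ev P \<noteq> 0" "ev Q \<noteq> 0" for P Q
    using \<phi>_nz[OF that(1)] \<phi>_nz[OF that(2)] by (simp only: sd_def \<phi>.hom_mult) simp
  have ev_mult: "ev [:p * p':] = ev ([:p:] * [:p':])" for p p'
    by (simp add: mult.commute)
  \<comment> \<open>The order of any fraction representing \<open>f\<close>; the next fact shows
    independence of the choice by cross-multiplication.\<close>
  define val where "val f = (if f = 0 then 0 else
      SOME n. \<exists>P s. s \<noteq> 0 \<and> f * ev [:s:] = ev P \<and> n = sd P - sd [:s:])" for f
  have val: "val f = sd P - sd [:s:]" if "f \<noteq> 0" "s \<noteq> 0" "f * ev [:s:] = ev P" for f P s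
  proof -
    have "\<exists>P s. s \<noteq> 0 \<and> f * ev [:s:] = ev P \<and> val f = sd P - sd [:s:]"
    proof -
      have "\<exists>n P s. s \<noteq> 0 \<and> f * ev [:s:] = ev P \<and> n = sd P - sd [:s:]"
        using that by blast
      from someI_ex[OF this] show ?thesis
        unfolding val_def using that(1) by simp
    qed
    then obtain P' s' where P': "s' \<noteq> 0" "f * ev [:s':] = ev P'" "val f = sd P' - sd [:s':]" by blast
    have "ev (P * [:s':]) = ev (P' * [:s:])"
      by (simp only: ev.hom_mult that(3)[symmetric] P'(2)[symmetric] mult_ac)
    from \<phi>_cong[OF this] have "sd (P * [:s':]) = sd (P' * [:s:])"
      by (simp only: sd_def)
    moreover have "ev P \<noteq> 0" "ev P' \<noteq> 0"
      using that P' by (simp_all flip: that(3) P'(2))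
    ultimately have "sd P + sd [:s':] = sd P' + sd [:s:]"
      using that(2) P'(1) by (metis sd_mult ev_const_eq_0_iff)
    then show ?thesis using P'(3) by simp
  qed
  have val_ev: "val (ev P) = sd P" if "ev P \<noteq> 0" for P
  proof -
    have "ev [:1:] = 1" using ev.hom_1 by (simp flip: one_pCons)
    moreover have "sd [:1:] = 0" using \<phi>.hom_1 by (simp add: sd_def flip: one_pCons)
    ultimately show ?thesis using val[OF that, of 1 P] by simp
  qed
  \<comment> \<open>As \<open>s\<close> vanishes at \<alpha>, its expansion has no constant term;
    this supplies the element of positive value needed for normalization.\<close>
  have gpos: "ev [:s:] \<noteq> 0" "val (ev [:s:]) > 0"
  proof -
    show nz: "ev [:s:] \<noteq> 0" using s by simp
    have "fps_nth (\<phi> [:s:]) 0 = 0"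
      using s by (simp add: \<phi>_0 coeff_hom.eval2_const[OF coeff_hom_to_ac])
    then have "subdegree (\<phi> [:s:]) > 0"
      using \<phi>_const[OF s(1)] subdegree_eq_0_iff[of "\<phi> [:s:]"] by blast
    then show "val (ev [:s:]) > 0"
      using val_ev[OF nz] by (simp add: sd_def)
  qed
  have common: "\<exists>P Q s. s \<noteq> 0 \<and> f * ev [:s:] = ev P \<and> g * ev [:s:] = ev Q" for f g
  proof -
    obtain P s where Ps: "s \<noteq> 0" "f * ev [:s:] = ev P" by (rule fraction)
    obtain Q t where Qt: "t \<noteq> 0" "g * ev [:t:] = ev Q" by (rule fraction)
    have "f * ev [:s * t:] = ev (P * [:t:])" "g * ev [:s * t:] = ev (Q * [:s:])"
      unfolding ev_mult ev.hom_mult Ps(2)[symmetric] Qt(2)[symmetric] by (simp_all add: mult_ac)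
    moreover have "s * t \<noteq> 0" using Ps Qt by simp
    ultimately show ?thesis by blast
  qed
  have val_mult: "val (f * g) = val f + val g" if fg: "f \<noteq> 0" "g \<noteq> 0" for f g
  proof -
    obtain P Q s where s: "s \<noteq> 0" "f * ev [:s:] = ev P" "g * ev [:s:] = ev Q" using common by blast
    have nz: "ev P \<noteq> 0" "ev Q \<noteq> 0" using fg s(1) by (simp_all flip: s(2,3))
    have "f * g * ev [:s * s:] = ev (P * Q)"
      unfolding ev_mult ev.hom_mult s(2)[symmetric] s(3)[symmetric] by (simp add: mult_ac)
    then have "val (f * g) = sd (P * Q) - sd [:s * s:]"
      using fg s(1) by (intro val) auto
    moreover have "sd [:s * s:] = sd [:s:] + sd [:s:]"
      using sd_mult[of "[:s:]" "[:s:]"] s(1) by simp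
    ultimately show ?thesis
      using val[OF fg(1) s(1,2)] val[OF fg(2) s(1,3)] sd_mult[OF nz] by linarith
  qed
  have val_add: "min (val f) (val g) \<le> val (f + g)"
    if fg: "f \<noteq> 0" "g \<noteq> 0" "f + g \<noteq> 0" for f g
  proof -
    obtain P Q s where s: "s \<noteq> 0" "f * ev [:s:] = ev P" "g * ev [:s:] = ev Q" using common by blast
    have fgs: "(f + g) * ev [:s:] = ev (P + Q)"
      using s by (simp add: distrib_right)
    then have "ev (P + Q) \<noteq> 0" using fg(3) s(1) by (metis ev_const_eq_0_iff mult_eq_0_iff)
    then have "\<phi> (P + Q) \<noteq> 0" by (rule \<phi>_nz)
    then have "min (subdegree (\<phi> P)) (subdegree (\<phi> Q)) \<le> subdegree (\<phi> (P + Q))"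
      using subdegree_add_ge'[of "\<phi> P" "\<phi> Q"] by simp
    then have "min (sd P) (sd Q) \<le> sd (P + Q)"
      unfolding sd_def by (simp add: min_def split: if_splits)
    then show ?thesis
      using val[OF fg(1) s(1,2)] val[OF fg(2) s(1,3)] val[OF fg(3) s(1) fgs] by simp
  qed
  have val_const: "val (\<iota> c) = 0" if "c \<noteq> 0" for c
  proof -
    have "sd [:[:c:]:] = 0" by (simp add: sd_def \<phi>_def coeff_hom.eval2_simps[OF c])
    then show ?thesis
      using val_ev[of "[:[:c:]:]"] that by (cases "\<iota> c = 0") (auto simp: val_def)
  qed
  have val_0: "val 0 = 0" by (simp add: val_def)
  obtain v e where v: "is_place \<iota> v" "e > 0" "\<And>f. val f = e * v f"
    by (rule normalize_valuation[OF val_0 val_mult val_add val_const gpos, of id]) (assumption, assumption, auto)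
  have vnn: "v f \<ge> 0 \<longleftrightarrow> val f \<ge> 0" for f
    using v(2) by (simp add: v(3) zero_le_mult_iff)
  have "val x \<ge> 0"
    using val_ev[of bvar_x] by (cases "x = 0") (simp_all add: val_0 sd_def)
  moreover have "eval2 to_ac \<alpha> \<beta> P = 0" if f: "f \<noteq> 0" "f * ev [:s:] = ev P" "v f \<ge> 0" for f P
  proof -
    \<comment> \<open>Nonnegative value means that the numerator vanishes at least as much as
      \<open>s\<close>, so its constant term, the value at (\<alpha>, \<beta>), is 0.\<close>
    have "sd P \<ge> sd [:s:]"
      using val[OF f(1) s(1) f(2)] f(3) vnn by simp
    moreover have "sd [:s:] > 0"
      using gpos val_ev by simp
    ultimately have "subdegree (\<phi> P) > 0" by (simp add: sd_def)
    then show ?thesis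
      using nth_less_subdegree_zero[of 0 "\<phi> P"] by (simp add: \<phi>_0)
  qed
  ultimately show ?thesis
    using that[OF v(1)] vnn by blast
qed

end

section \<open>Regular functions\<close>

text \<open>An annihilating polynomial of least degree divides every other one, since the remainder
  vanishes at \<alpha> too.\<close>

lemma exists_minimal_poly:
  fixes \<alpha> :: "'a::field alg_closure"
  assumes "s \<noteq> 0" "poly (map_poly to_ac s) \<alpha> = 0"
  obtains p where "degree p > 0" "\<And>c. poly (map_poly to_ac c) \<alpha> = 0 \<Longrightarrow> p dvd c"
proof -
  interpret e: coeff_hom "\<lambda>c. poly (map_poly to_ac c) \<alpha>"
    by (rule coeff_hom.poly_map_poly[OF coeff_hom_to_ac])
  obtain p where p: "p \<noteq> 0" "poly (map_poly to_ac p) \<alpha> = 0"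
    and least: "\<And>c. c \<noteq> 0 \<Longrightarrow> poly (map_poly to_ac c) \<alpha> = 0 \<Longrightarrow> degree p \<le> degree c"
    using ex_has_least_nat[of "\<lambda>c. c \<noteq> 0 \<and> poly (map_poly to_ac c) \<alpha> = 0" s degree] assms by blast
  have "degree p > 0"
  proof (rule ccontr)
    assume "\<not> degree p > 0"
    then obtain a where "p = [:a:]" by (auto elim: degree_eq_zeroE)
    then show False using p by (simp add: map_poly_pCons)
  qed
  moreover have "p dvd c" if "poly (map_poly to_ac c) \<alpha> = 0" for c
  proof -
    have "c mod p = c - p * (c div p)" by (simp add: minus_mult_div_eq_mod)
    then have "poly (map_poly to_ac (c mod p)) \<alpha> = 0"
      using that p by (simp only: e.hom_diff e.hom_mult) simp
    then have "c mod p = 0"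
      using least[of "c mod p"] degree_mod_less'[OF p(1), of c] by linarith
    then show ?thesis by (simp add: dvd_eq_mod_eq_0)
  qed
  ultimately show ?thesis using that by blast
qed

context suzuki_infinite
begin

text \<open>One root exists over the algebraic closure, and translation by the elements of F_q gives
  q distinct ones, because c^q + c = c + c = 0.\<close>

lemma suz_rel_fibre:
  fixes \<alpha> :: "'a alg_closure"
  obtains B where "card B = q" "\<And>\<beta>. \<beta> \<in> B \<Longrightarrow> suz_rel q0 \<alpha> \<beta> = 0"
proof -
  define h where "h = \<alpha> ^ q0 * (\<alpha> ^ q + \<alpha>)"
  define p where "p = monom 1 q + [:- h, 1:]"
  have "degree [:- h, 1:] < degree (monom (1 :: 'a alg_closure) q)"
    using q_ge_2 by (simp add: degree_monom_eq)
  then have "degree p = q"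
    unfolding p_def by (subst degree_add_eq_left) (simp_all add: degree_monom_eq)
  then have "degree p > 0" using q0_pos by simp
  then obtain \<beta> where "poly p \<beta> = 0" using alg_closed_imp_poly_has_root by blast
  then have \<beta>: "\<beta> ^ q + \<beta> = h"
    by (simp add: p_def poly_monom add_diff_eq)
  have char: "CHAR('a alg_closure) = 2" using char2_base by simp
  have q: "q = 2 ^ Suc (2 * m)" unfolding q0_def by (simp add: power_even_eq)
  let ?B = "range (\<lambda>c. \<beta> + to_ac c)"
  have "inj (\<lambda>c. \<beta> + to_ac c)" by (rule injI) simp
  then have "card ?B = q" by (simp add: card_image card)
  moreover have "suz_rel q0 \<alpha> (\<beta> + to_ac c) = 0" for c
  proof -
    have "(\<beta> + to_ac c) ^ q = \<beta> ^ q + to_ac (c ^ q)"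
      unfolding q using add_power_CHAR_2[OF char, of \<beta> "to_ac c" "Suc (2 * m)"] by simp
    also have "c ^ q = c" using finite_field_power_card[of c] card by simp
    finally have "(\<beta> + to_ac c) ^ q + (\<beta> + to_ac c) = (\<beta> ^ q + \<beta>) + (to_ac c + to_ac c)"
      by (simp add: algebra_simps)
    then show ?thesis
      unfolding suz_rel_def \<beta> by (simp add: add_self_CHAR_2[OF char] h_def)
  qed
  ultimately show ?thesis using that[of ?B] by blast
qed

lemma regular_imp_ev:
  assumes reg: "\<And>v. is_place \<iota> v \<Longrightarrow> v \<noteq> Pinf \<Longrightarrow> v f \<ge> 0"
  obtains P where "f = ev P"
proof (cases "f = 0")
  case True
  then show ?thesis using that[of 0] by simp
next
  case False
  obtain P0 s0 where "s0 \<noteq> 0" "f * ev [:s0:] = ev P0" by (rule fraction)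
  \<comment> \<open>A denominator of least degree; a root of it will lead to a smaller one.\<close>
  then obtain s where s: "s \<noteq> 0" "\<exists>P. f * ev [:s:] = ev P"
    and least: "\<And>t P. t \<noteq> 0 \<Longrightarrow> f * ev [:t:] = ev P \<Longrightarrow> degree s \<le> degree t"
    using ex_has_least_nat[of "\<lambda>s. s \<noteq> 0 \<and> (\<exists>P. f * ev [:s:] = ev P)" s0 degree] by blast
  from s(2) obtain P where "f * ev [:s:] = ev P" by blast
  moreover obtain R where R: "degree R < q" "ev R = ev P" by (rule ev_reduce)
  ultimately have fR: "f * ev [:s:] = ev R" by simp
  have "degree s = 0"
  proof (rule ccontr)
    assume "degree s \<noteq> 0"
    then have "degree (map_poly to_ac s) > 0" by (simp add: degree_map_poly)
    then obtain \<alpha> where \<alpha>: "poly (map_poly to_ac s) \<alpha> = 0"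
      using alg_closed_imp_poly_has_root by blast
    obtain B where B: "card B = q" "\<And>\<beta>. \<beta> \<in> B \<Longrightarrow> suz_rel q0 \<alpha> \<beta> = 0"
      using suz_rel_fibre by blast
    have root: "eval2 to_ac \<alpha> \<beta> R = 0" if \<beta>: "\<beta> \<in> B" for \<beta>
    proof -
      obtain v where v: "is_place \<iota> v" "v x \<ge> 0"
        "\<And>f P. f \<noteq> 0 \<Longrightarrow> f * ev [:s:] = ev P \<Longrightarrow> v f \<ge> 0 \<Longrightarrow> eval2 to_ac \<alpha> \<beta> P = 0"
        using finite_place_exists[OF B(2)[OF \<beta>] s(1) \<alpha>] by blast
      have "v \<noteq> Pinf" using v(2) Pinf_x by auto
      then show ?thesis using v(3)[OF False fR] reg[OF v(1)] by blast
    qed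
    define R\<alpha> where "R\<alpha> = map_poly (\<lambda>p. poly (map_poly to_ac p) \<alpha>) R"
    \<comment> \<open>A nonzero polynomial of degree below q cannot vanish on all q points of
      \<open>B\<close>.\<close>
    have "R\<alpha> = 0"
    proof (rule ccontr)
      assume nz: "R\<alpha> \<noteq> 0"
      have "B \<subseteq> {\<beta>. poly R\<alpha> \<beta> = 0}"
        using root by (auto simp: R\<alpha>_def eval2_def)
      then have "q \<le> card {\<beta>. poly R\<alpha> \<beta> = 0}"
        unfolding B(1)[symmetric] using poly_roots_finite[OF nz] by (rule card_mono[rotated])
      also have "\<dots> \<le> degree R\<alpha>" by (rule card_poly_roots_bound[OF nz])
      also have "\<dots> \<le> degree R" unfolding R\<alpha>_def by (rule map_poly_degree_leq)
      finally show False using R(1) by simp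
    qed
    then have coeffs: "poly (map_poly to_ac (coeff R i)) \<alpha> = 0" for i
      unfolding R\<alpha>_def by (metis (no_types, lifting) coeff_0 coeff_map_poly map_poly_0 poly_0)
    \<comment> \<open>\<open>p\<close> divides \<open>s\<close> and every coefficient of
      \<open>R\<close>, so it cancels from the fraction and leaves the smaller denominator
      \<open>t\<close>.\<close>
    obtain p where p: "degree p > 0" "\<And>c. poly (map_poly to_ac c) \<alpha> = 0 \<Longrightarrow> p dvd c"
      using exists_minimal_poly[OF s(1) \<alpha>] by blast
    obtain t where t: "s = p * t" using p(2)[OF \<alpha>] ..
    have "[:p:] dvd R" using p(2) coeffs by (simp add: const_poly_dvd_iff)
    then obtain R' where R': "R = [:p:] * R'" ..
    have nz: "p \<noteq> 0" "t \<noteq> 0" using s(1) t by auto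
    have "[:s:] = [:p:] * [:t:]" by (simp add: t mult.commute)
    then have "ev [:p:] * (f * ev [:t:]) = ev [:p:] * ev R'"
      using fR unfolding R' by (simp only: ev.hom_mult mult_ac)
    then have "f * ev [:t:] = ev R'" using nz by simp
    from least[OF nz(2) this] show False
      using p(1) nz by (simp add: t degree_mult_eq)
  qed
  then obtain a where a: "s = [:a:]" by (rule degree_eq_zeroE)
  then have "a \<noteq> 0" using s by simp
  have "ev ([:[:inverse a:]:] * R) = \<iota> (inverse a) * (f * \<iota> a)"
    using fR by (simp only: ev.hom_mult a \<iota>.eval2_simps)
  also have "\<dots> = f * \<iota> (a * inverse a)" by (simp only: \<iota>.hom_mult mult_ac)
  also have "\<dots> = f" using \<open>a \<noteq> 0\<close> by simp
  finally show ?thesis using that by metis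
qed

text \<open>The elements of the space are the combinations of monomials of weight at most
  \<open>N\<close>, since the pole order of a combination is its largest weight.\<close>

lemma suz_basis:
  fixes l N :: nat
  assumes N: "N = l * ((2 * q0\<^sup>2)\<^sup>2 + 1)" and l: "l < (2 * q0\<^sup>2)\<^sup>2"
  defines "E \<equiv> {(a, b, c, d, r). suz_wt q0 (a, b, c, d, r) \<le> N \<and>
    a < 2 * q0\<^sup>2 \<and> b \<le> 1 \<and> c < q0 \<and> d < q0 \<and> r \<le> l}"
  shows "Fq_basis \<iota> (mon ` E) (RR_space \<iota> (\<lambda>P. if P = Pinf then int N else 0))"
proof -
  note norm = infinite_place_normalized[OF Pinf Pinf_x]
  have sum: "(\<Sum>e\<in>I. \<iota> (\<gamma> e) * mon e) \<noteq> 0"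
      "Pinf (\<Sum>e\<in>I. \<iota> (\<gamma> e) * mon e) = - int (Max (suz_wt q0 ` I))"
    if "finite I" "I \<noteq> {}" "I \<subseteq> suz_expos q0" "\<And>e. e \<in> I \<Longrightarrow> \<gamma> e \<noteq> 0" for I \<gamma>
    using infinite_place_sum[OF Pinf, of 1 I \<gamma>] norm that by simp_all
  have E: "E \<subseteq> suz_expos q0" "\<And>e. e \<in> E \<Longrightarrow> suz_wt q0 e \<le> N"
    by (auto simp: E_def suz_expos_def)
  \<comment> \<open>The bound on \<open>r\<close> follows from the weight bound:
    \<open>l < q\<^sup>2\<close> gives N = l q^2 + l < (l + 1) q^2.\<close>
  have EI: "e \<in> E" if "e \<in> suz_expos q0" "suz_wt q0 e \<le> N" for e
  proof (cases e)
    case (fields a b c d r)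
    let ?q2 = "(2 * q0\<^sup>2)\<^sup>2"
    have "r * ?q2 \<le> N" using that(2) unfolding fields suz_wt.simps by linarith
    also have "N < (l + 1) * ?q2" using l by (simp add: N)
    finally have "r < l + 1" by (metis mult_less_cancel2)
    then show ?thesis using that by (simp add: E_def suz_expos_def fields)
  qed
  have "E \<subseteq> {..2 * q0\<^sup>2} \<times> {..1} \<times> {..q0} \<times> {..q0} \<times> {..l}"
    by (auto simp: E_def)
  then have fin: "finite E" by (rule finite_subset) simp
  have inj: "inj_on mon E"
  proof (rule inj_onI)
    fix e e' assume "e \<in> E" "e' \<in> E" "mon e = mon e'"
    then show "e = e'"
      using norm(2)[of e] norm(2)[of e'] E(1) suz_wt_inj[of q0] by (auto dest: inj_onD)
  qed
  show ?thesis
    unfolding Fq_basis_def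
  proof (intro conjI allI ballI impI)
    show "finite (mon ` E)" using fin by simp
    show "mon ` E \<subseteq> RR_space \<iota> (\<lambda>P. if P = Pinf then int N else 0)"
    proof
      fix t assume "t \<in> mon ` E"
      then obtain e where e: "e \<in> E" "t = mon e" by blast
      have "P t + (if P = Pinf then int N else 0) \<ge> 0" if "is_place \<iota> P" for P
        using finite_place_mon[OF that] norm(2)[of e] E(2)[OF e(1)] by (cases "P = Pinf") (auto simp: e(2))
      then show "t \<in> RR_space \<iota> (\<lambda>P. if P = Pinf then int N else 0)"
        unfolding RR_space_def by blast
    qed
  next
    fix c t assume 0: "(\<Sum>t\<in>mon ` E. \<iota> (c t) * t) = 0" and t: "t \<in> mon ` E"
    define I where "I = {e \<in> E. c (mon e) \<noteq> 0}"
    have "(\<Sum>t\<in>mon ` E. \<iota> (c t) * t) = (\<Sum>e\<in>E. \<iota> (c (mon e)) * mon e)"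
      by (simp add: sum.reindex[OF inj])
    also have "\<dots> = (\<Sum>e\<in>I. \<iota> (c (mon e)) * mon e)"
      by (rule sum.mono_neutral_right) (use fin in \<open>auto simp: I_def\<close>)
    finally have "(\<Sum>e\<in>I. \<iota> (c (mon e)) * mon e) = 0" using 0 by simp
    moreover have "finite I" "I \<subseteq> suz_expos q0" "\<And>e. e \<in> I \<Longrightarrow> c (mon e) \<noteq> 0"
      using fin E(1) by (auto simp: I_def)
    ultimately have "I = {}" using sum(1)[of I "\<lambda>e. c (mon e)"] by blast
    then show "c t = 0" using t by (auto simp: I_def)
  next
    fix f assume f: "f \<in> RR_space \<iota> (\<lambda>P. if P = Pinf then int N else 0)"
    show "\<exists>c. f = (\<Sum>t\<in>mon ` E. \<iota> (c t) * t)"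
    proof (cases "f = 0")
      case True
      then show ?thesis by (intro exI[of _ "\<lambda>_. 0"]) simp
    next
      case False
      then have places: "P f + (if P = Pinf then int N else 0) \<ge> 0" if "is_place \<iota> P" for P
        using f that by (auto simp: RR_space_def)
      obtain P where P: "f = ev P"
        using regular_imp_ev[of f] places by fastforce
      obtain I \<gamma> where I: "finite I" "I \<subseteq> suz_expos q0" "\<And>e. e \<in> I \<Longrightarrow> \<gamma> e \<noteq> 0"
        and dvd: "rel dvd P - (\<Sum>e\<in>I. [:[:\<gamma> e:]:] * suz_mon q0 bvar_x bvar_y e)"
        and ev: "ev P = (\<Sum>e\<in>I. \<iota> (\<gamma> e) * mon e)"
        by (rule ev_repr[of P]) blast
      have ne: "I \<noteq> {}" using False P ev by auto
      \<comment> \<open>This maximum is the pole order of \<open>f\<close> at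
        \<open>Pinf\<close>.\<close>
      have "Max (suz_wt q0 ` I) \<le> N"
        using sum(2)[OF I(1) ne I(2,3)] places[OF Pinf] by (simp add: P ev)
      then have "suz_wt q0 e \<le> N" if "e \<in> I" for e
        using that I(1) by (meson Max_ge finite_imageI imageI order.trans)
      then have IE: "I \<subseteq> E" using I(2) EI by blast
      \<comment> \<open>\<open>Fq_basis\<close> indexes coefficients by the basis elements
        themselves, so the exponent is recovered by inverting \<open>mon\<close> on
        \<open>E\<close>.\<close>
      define c where "c t = (let e = inv_into E mon t in if e \<in> I then \<gamma> e else 0)" for t
      have c: "c (mon e) = (if e \<in> I then \<gamma> e else 0)" if "e \<in> E" for e
        using that inj by (simp add: c_def)
      have "(\<Sum>t\<in>mon ` E. \<iota> (c t) * t) = (\<Sum>e\<in>E. \<iota> (c (mon e)) * mon e)"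
        by (simp add: sum.reindex[OF inj])
      also have "\<dots> = (\<Sum>e\<in>I. \<iota> (\<gamma> e) * mon e)"
        by (rule sum.mono_neutral_cong_right) (use fin IE c in auto)
      finally show ?thesis using P ev by metis
    qed
  qed
qed

end

theorem theorem3p2:
  fixes m l :: nat
    and \<iota> :: "'a::{field,finite} \<Rightarrow> 'b::field"
    and x y :: 'b
    and Pinf :: "'b \<Rightarrow> int"
  assumes m: "m \<ge> 1"
    and card: "card (UNIV :: 'a set) = 2 ^ (2 * m + 1)"
    and hom: "is_field_hom \<iota>"
    and gen: "generated_by \<iota> x y"
    and transc: "transcendental_over \<iota> x"
    and curve: "y ^ (2 ^ (2 * m + 1)) + y = x ^ (2 ^ m) * (x ^ (2 ^ (2 * m + 1)) + x)"
    and Pinf: "is_place \<iota> Pinf" "Pinf x < 0"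
    and ell: "l \<le> (2 ^ (2 * m + 1)) ^ 2 - 1"
  shows
    "let q0 = (2::nat) ^ m; q = (2::nat) ^ (2 * m + 1);
         z = x ^ (2 * q0 + 1) - y ^ (2 * q0);
         w = x * y ^ (2 * q0) - z ^ (2 * q0)
     in Fq_basis \<iota>
          {x ^ a * y ^ b * z ^ c * w ^ d * (x ^ q + x) ^ r | a b c d r.
             a * q + b * (q + q0) + c * (q + 2 * q0) + d * (q + 2 * q0 + 1) + r * q ^ 2
               \<le> l * (q ^ 2 + 1)
             \<and> a \<le> q - 1 \<and> b \<le> 1 \<and> c \<le> q0 - 1 \<and> d \<le> q0 - 1 \<and> r \<le> l}
          (RR_space \<iota> (\<lambda>P. if P = Pinf then int (l * (q ^ 2 + 1)) else 0))"
proof -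
  define q0 q :: nat where "q0 = 2 ^ m" and "q = 2 ^ (2 * m + 1)"
  have q: "q = 2 * q0\<^sup>2" by (simp add: q_def q0_def power_even_eq)
  have pos: "q0 > 0" "q > 0" by (simp_all add: q0_def q_def)
  interpret suzuki_infinite m \<iota> x y q0 Pinf
  proof
    show "q0 = 2 ^ m" by (fact q0_def)
    show "card (UNIV :: 'a set) = 2 * q0\<^sup>2" using card unfolding q[symmetric] q_def .
    show "suz_rel q0 x y = 0"
      using curve unfolding suz_rel_def q[symmetric] q0_def[symmetric] q_def[symmetric] by simp
  qed (fact hom gen transc Pinf)+
  define z where "z = suz_z q0 x y"
  define w where "w = suz_w q0 x y"
  \<comment> \<open>Positivity of \<open>q\<close> and \<open>q0\<close> keeps the natural-number
    subtraction from truncating.\<close>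
  have bounds: "k \<le> q - 1 \<longleftrightarrow> k < q" "k \<le> q0 - 1 \<longleftrightarrow> k < q0" for k
    using pos by auto
  have "{x ^ a * y ^ b * z ^ c * w ^ d * (x ^ q + x) ^ r | a b c d r.
             a * q + b * (q + q0) + c * (q + 2 * q0) + d * (q + 2 * q0 + 1) + r * q ^ 2
               \<le> l * (q ^ 2 + 1)
             \<and> a \<le> q - 1 \<and> b \<le> 1 \<and> c \<le> q0 - 1 \<and> d \<le> q0 - 1 \<and> r \<le> l} =
      suz_mon q0 x y ` {(a, b, c, d, r). suz_wt q0 (a, b, c, d, r) \<le> l * (q\<^sup>2 + 1) \<and>
        a < q \<and> b \<le> 1 \<and> c < q0 \<and> d < q0 \<and> r \<le> l}" (is "?A = ?B")
  proof (intro subset_antisym subsetI)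
    fix t assume "t \<in> ?A"
    then obtain a b c d r where "t = suz_mon q0 x y (a, b, c, d, r)"
      "suz_wt q0 (a, b, c, d, r) \<le> l * (q\<^sup>2 + 1)" "a < q" "b \<le> 1" "c < q0" "d < q0" "r \<le> l"
      unfolding suz_mon.simps suz_wt.simps q[symmetric] z_def[symmetric] w_def[symmetric] bounds
      by blast
    then show "t \<in> ?B" by blast
  next
    fix t assume "t \<in> ?B"
    then obtain a b c d r where "t = suz_mon q0 x y (a, b, c, d, r)"
      "suz_wt q0 (a, b, c, d, r) \<le> l * (q\<^sup>2 + 1)" "a < q" "b \<le> 1" "c < q0" "d < q0" "r \<le> l"
      by blast
    then show "t \<in> ?A"
      unfolding suz_mon.simps suz_wt.simps q[symmetric] z_def[symmetric] w_def[symmetric] bounds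
      by blast
  qed
  moreover have "l < q\<^sup>2" 
  proof -
    have "l \<le> q\<^sup>2 - 1" using ell unfolding q_def .
    moreover have "q\<^sup>2 > 0" using pos by simp
    ultimately show ?thesis by linarith
  qed
  ultimately have "Fq_basis \<iota> ?A (RR_space \<iota> (\<lambda>P. if P = Pinf then int (l * (q\<^sup>2 + 1)) else 0))"
    using suz_basis[of "l * (q\<^sup>2 + 1)" l] by (simp only: q[symmetric] refl)
  then show ?thesis
    unfolding Let_def z_def w_def suz_w_def suz_z_def q0_def[symmetric] q_def[symmetric] .
qed

end
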